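(* Let $L$ be a fixed graph and $H$ a finite, simple, connected graph. There are positive integer-valued functions $f,g,h$ of $(\varepsilon,H)$ such that for every $\varepsilon\in(0,1)$ and every $L$-minor-free graph $G$: if $G$ is $H$-free, then $\mathrm{RBE}(G,H,\varepsilon)$ accepts $G$; and if $G$ is $\varepsilon$-far from $H$-free, then $\mathrm{RBE}(G,H,\varepsilon)$ rejects $G$ with probability at least $0.99$.
   Context: $G$ is $L$-minor-free if $L$ cannot be obtained from $G$ by vertex deletions, edge deletions and edge contractions. Access to $G=(V,E)$, $V=\{1,\dots,n\}$, is via the random neighbor oracle: a query on $v$ returns a uniformly random neighbor of $v$, independently. $\mathrm{Traverse}(G,v,d,\ell)$: set $L_0=\{v\}$; for $j=1,\dots,\ell$, each $u\in L_{j-1}$ makes $d$ random neighbor queries obtaining $\Gamma_u$, recording edges $(u,x)$, $x\in\Gamma_u$; $L_j$ is the union of the $\Gamma_u$ minus earlier levels; return the subgraph of recorded edges. $\mathrm{RBE}(G,H,\varepsilon)$: repeat $f(\varepsilon,H)$ times: pick $v\in V$ uniformly at random, run $\mathrm{Traverse}(G,v,h(\varepsilon,H),g(\varepsilon,H))$, and reject if the returned subgraph contains a copy of $H$; otherwise accept. $G$ is $\varepsilon$-far from $H$-free if more than $\varepsilon|V|$ edges must be deleted to obtain a graph with no subgraph isomorphic to $H$. *)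

theory Defs
  imports "HOL-Probability.Probability" "HOL-Probability.Product_PMF"
begin

section \<open>Finite simple graphs and minors\<close>

record 'a ugraph =
  verts :: "'a set"
  edges :: "'a set set"

definition simple_graph :: "'a ugraph \<Rightarrow> bool" where
  "simple_graph G \<longleftrightarrow> finite (verts G) \<and> (\<forall>e\<in>edges G. e \<subseteq> verts G \<and> card e = 2)"

text \<open>The graph without vertices does not count as connected.\<close>

definition connected_graph :: "'a ugraph \<Rightarrow> bool" where
  "connected_graph G \<longleftrightarrow> verts G \<noteq> {} \<and>
     (\<forall>u\<in>verts G. \<forall>v\<in>verts G. (u, v) \<in> {(x, y). {x, y} \<in> edges G}\<^sup>*)"

definition graph_iso :: "'a ugraph \<Rightarrow> 'b ugraph \<Rightarrow> bool" where
  "graph_iso G H \<longleftrightarrow>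
     (\<exists>\<phi>. bij_betw \<phi> (verts G) (verts H) \<and> edges H = (\<lambda>e. \<phi> ` e) ` edges G)"

definition subgraph_of :: "'a ugraph \<Rightarrow> 'a ugraph \<Rightarrow> bool" where
  "subgraph_of S G \<longleftrightarrow> simple_graph S \<and> verts S \<subseteq> verts G \<and> edges S \<subseteq> edges G"

definition contains_copy :: "'a ugraph \<Rightarrow> 'b ugraph \<Rightarrow> bool" where
  "contains_copy G H \<longleftrightarrow> (\<exists>S. subgraph_of S G \<and> graph_iso S H)"

definition subgraph_free :: "'a ugraph \<Rightarrow> 'b ugraph \<Rightarrow> bool" where
  "subgraph_free G H \<longleftrightarrow> \<not> contains_copy G H"

definition delete_vertex :: "'a ugraph \<Rightarrow> 'a \<Rightarrow> 'a ugraph" where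
  "delete_vertex G v = \<lparr>verts = verts G - {v}, edges = {e \<in> edges G. v \<notin> e}\<rparr>"

definition delete_edges :: "'a ugraph \<Rightarrow> 'a set set \<Rightarrow> 'a ugraph" where
  "delete_edges G F = \<lparr>verts = verts G, edges = edges G - F\<rparr>"

text \<open>Contraction of the edge \<open>{u, v}\<close> merges \<open>v\<close> into \<open>u\<close>; the loop is dropped, and parallel
  edges are identified since the edges form a set.\<close>

definition contract_edge :: "'a ugraph \<Rightarrow> 'a \<Rightarrow> 'a \<Rightarrow> 'a ugraph" where
  "contract_edge G u v =
     \<lparr>verts = verts G - {v},
      edges = {e \<in> edges G. v \<notin> e} \<union> {{u, w} |w. {v, w} \<in> edges G \<and> w \<noteq> u}\<rparr>"

inductive minor_step :: "'a ugraph \<Rightarrow> 'a ugraph \<Rightarrow> bool" where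
  vertex_deletion: "v \<in> verts G \<Longrightarrow> minor_step G (delete_vertex G v)"
| edge_deletion: "e \<in> edges G \<Longrightarrow> minor_step G (delete_edges G {e})"
| edge_contraction: "{u, v} \<in> edges G \<Longrightarrow> minor_step G (contract_edge G u v)"

definition has_minor :: "'a ugraph \<Rightarrow> 'b ugraph \<Rightarrow> bool" where
  "has_minor G L \<longleftrightarrow> (\<exists>K. minor_step\<^sup>*\<^sup>* G K \<and> graph_iso K L)"

definition minor_free :: "'a ugraph \<Rightarrow> 'b ugraph \<Rightarrow> bool" where
  "minor_free G L \<longleftrightarrow> \<not> has_minor G L"

text \<open>If \<open>H\<close> has no edges, it may be that no edge deletion makes \<open>G\<close> free of \<open>H\<close>; then \<open>G\<close> is
  \<open>\<epsilon>\<close>-far for every \<open>\<epsilon>\<close>.\<close>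

definition far_from_free :: "real \<Rightarrow> 'a ugraph \<Rightarrow> 'b ugraph \<Rightarrow> bool" where
  "far_from_free \<epsilon> G H \<longleftrightarrow>
     (\<forall>F\<subseteq>edges G. subgraph_free (delete_edges G F) H \<longrightarrow>
        real (card F) > \<epsilon> * real (card (verts G)))"

section \<open>Random exploration\<close>

definition neighbors :: "'a ugraph \<Rightarrow> 'a \<Rightarrow> 'a set" where
  "neighbors G v = {u. {v, u} \<in> edges G}"

text \<open>A query on an isolated vertex returns \<open>None\<close>.\<close>

definition random_neighbor :: "'a ugraph \<Rightarrow> 'a \<Rightarrow> 'a option pmf" where
  "random_neighbor G v =
     (if neighbors G v = {} then return_pmf None
      else map_pmf Some (pmf_of_set (neighbors G v)))"

definition query_answers :: "'a ugraph \<Rightarrow> nat \<Rightarrow> 'a \<Rightarrow> 'a set pmf" where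
  "query_answers G d u =
     map_pmf (\<lambda>xs. {x. Some x \<in> set xs}) (replicate_pmf d (random_neighbor G u))"

text \<open>State of the traversal: the union \<open>S\<close> of all levels so far, the current level \<open>C\<close>, and the
  recorded edges \<open>R\<close>. The vertices of the returned graph are the vertices of all levels, so that
  the start vertex belongs to it even if no edge has been recorded.\<close>

primrec explore_levels ::
  "'a ugraph \<Rightarrow> nat \<Rightarrow> nat \<Rightarrow> 'a set \<Rightarrow> 'a set \<Rightarrow> 'a set set \<Rightarrow> 'a ugraph pmf" where
  "explore_levels G d 0 S C R = return_pmf \<lparr>verts = S, edges = R\<rparr>"
| "explore_levels G d (Suc l) S C R =
     bind_pmf (Pi_pmf C {} (query_answers G d))
       (\<lambda>\<Gamma>. explore_levels G d l
          (S \<union> (\<Union>u\<in>C. \<Gamma> u))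
          ((\<Union>u\<in>C. \<Gamma> u) - S)
          (R \<union> {{u, x} |u x. u \<in> C \<and> x \<in> \<Gamma> u}))"

definition traverse :: "'a ugraph \<Rightarrow> 'a \<Rightarrow> nat \<Rightarrow> nat \<Rightarrow> 'a ugraph pmf" where
  "traverse G v d l = explore_levels G d l {v} {v} {}"

datatype verdict = Accept | Reject

primrec rbe_rounds :: "nat \<Rightarrow> nat \<Rightarrow> nat \<Rightarrow> 'a ugraph \<Rightarrow> 'b ugraph \<Rightarrow> verdict pmf" where
  "rbe_rounds 0 d l G H = return_pmf Accept"
| "rbe_rounds (Suc k) d l G H =
     bind_pmf (pmf_of_set (verts G))
       (\<lambda>v. bind_pmf (traverse G v d l)
          (\<lambda>K. if contains_copy K H then return_pmf Reject else rbe_rounds k d l G H))"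

definition rbe ::
  "(real \<Rightarrow> 'b ugraph \<Rightarrow> nat) \<Rightarrow> (real \<Rightarrow> 'b ugraph \<Rightarrow> nat) \<Rightarrow> (real \<Rightarrow> 'b ugraph \<Rightarrow> nat) \<Rightarrow>
     'a ugraph \<Rightarrow> 'b ugraph \<Rightarrow> real \<Rightarrow> verdict pmf" where
  "rbe f g h G H \<epsilon> = rbe_rounds (f \<epsilon> H) (h \<epsilon> H) (g \<epsilon> H) G H"

end

theory Submission
  imports Defs
begin

text \<open>
  If \<open>G\<close> is far from \<open>H\<close>-free, a maximal family of edge-disjoint copies of \<open>H\<close> has linearly many
  members. By pigeonhole and colour coding, a constant fraction of them has coloured vertices and
  degrees that increase with the colour. In a minor-free graph, sums of the form
  \<open>\<Sum> min (deg v) (deg w)\<close> over the edges of a minor are linear in the number of vertices (count the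
  edges among the vertices of degree at least \<open>s\<close>, for every \<open>s\<close>). Hence, going through the colours
  upwards, one can pass to a constant fraction of the copies in which a vertex of colour \<open>i\<close>
  determines the vertices in the higher colours that are joined to \<open>i\<close> through lower colours.
  Finally one discards vertices only a small part of whose degree is used by the copies, so that a
  random neighbour query at a remaining vertex continues along a copy with constant probability.

  If every visited vertex receives, for each required colour, an answer along some copy (a union
  bound over the boundedly many visited vertices), then the answers need not belong to
  the same copy, but the determination property glues them to a copy of \<open>H\<close> from the highest
  colour downwards.
\<close>

section \<open>Clique minors in dense families of branch sets\<close>

text \<open>Degrees are unbounded, so boundedly many queries at a vertex usually miss any prescribed
  edge. All that can be demanded is an answer along some copy, and every query may thereby change
  the copy. One would like each colour to determine its neighbouring colours, but this is possible
  in one direction only: if many triangles share a hub, the hub cannot determine its partners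
  without losing almost all copies. Towards growing degree it is possible, since the degree of the
  endpoint of smaller degree has a linear sum over the edges. Eliminating the colours from low to
  high tells how much one-sided determination suffices: a change of copy below a colour then
  disturbs neither that colour nor the higher ones attached to it. The depth
  \<open>k * (k * k) + 1\<close> pays for \<open>k\<close> walks of at most \<open>k * k\<close>
  steps each, one to the top colour and one for every descent, and for one more step that reads off
  the edges. The density constant comes from Mader's exponential bound for complete minors.\<close>

definition connected_in :: "'a set set \<Rightarrow> 'a set \<Rightarrow> bool" where
  "connected_in E X \<longleftrightarrow>
     (\<forall>x\<in>X. \<forall>y\<in>X. (x, y) \<in> {(a, b). {a, b} \<in> E \<and> a \<in> X \<and> b \<in> X}\<^sup>*)"

definition touching :: "'a set set \<Rightarrow> 'a set \<Rightarrow> 'a set \<Rightarrow> bool" where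
  "touching E X Y \<longleftrightarrow> (\<exists>x\<in>X. \<exists>y\<in>Y. {x, y} \<in> E)"

lemma touching_commute: "touching E X Y \<longleftrightarrow> touching E Y X"
  unfolding touching_def by (metis insert_commute)

lemma touching_Un: "touching E (X \<union> Y) Z \<longleftrightarrow> touching E X Z \<or> touching E Y Z"
  unfolding touching_def by blast

lemma connected_in_Un:
  assumes "connected_in E X" "connected_in E Y" "touching E X Y"
  shows "connected_in E (X \<union> Y)"
proof -
  let ?R = "\<lambda>Z. {(a, b). {a, b} \<in> E \<and> a \<in> Z \<and> b \<in> Z}"
  obtain x y where xy: "x \<in> X" "y \<in> Y" "{x, y} \<in> E"
    using assms(3) unfolding touching_def by blast
  have mono: "(?R Z)\<^sup>* \<subseteq> (?R (X \<union> Y))\<^sup>*" if "Z \<subseteq> X \<union> Y" for Z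
    using that by (intro rtrancl_mono) auto
  have X: "(a, b) \<in> (?R (X \<union> Y))\<^sup>*" if "a \<in> X" "b \<in> X" for a b
    using assms(1) that mono[of X] unfolding connected_in_def by blast
  have Y: "(a, b) \<in> (?R (X \<union> Y))\<^sup>*" if "a \<in> Y" "b \<in> Y" for a b
    using assms(2) that mono[of Y] unfolding connected_in_def by blast
  have "(x, y) \<in> ?R (X \<union> Y)" "(y, x) \<in> ?R (X \<union> Y)"
    using xy by (auto simp: insert_commute)
  then have xy': "(x, y) \<in> (?R (X \<union> Y))\<^sup>*" "(y, x) \<in> (?R (X \<union> Y))\<^sup>*"
    by blast+
  have XY: "(a, b) \<in> (?R (X \<union> Y))\<^sup>*" if "a \<in> X" "b \<in> Y" for a b
    using X[OF that(1) xy(1)] xy'(1) Y[OF xy(2) that(2)] by (meson rtrancl_trans)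
  have YX: "(a, b) \<in> (?R (X \<union> Y))\<^sup>*" if "a \<in> Y" "b \<in> X" for a b
    using Y[OF that(1) xy(2)] xy'(2) X[OF xy(1) that(2)] by (meson rtrancl_trans)
  show ?thesis unfolding connected_in_def using X Y XY YX by blast
qed

definition branch_family :: "'a ugraph \<Rightarrow> 'a set set \<Rightarrow> bool" where
  "branch_family G \<B> \<longleftrightarrow> finite \<B> \<and> disjoint \<B> \<and>
     (\<forall>X\<in>\<B>. X \<noteq> {} \<and> X \<subseteq> verts G \<and> connected_in (edges G) X)"

text \<open>The edges of the graph obtained by contracting every set of the family, as ordered
  pairs: each is counted twice, so \<open>card (links E \<B>) / card \<B>\<close> is an average
  degree.\<close>

definition links :: "'a set set \<Rightarrow> 'a set set \<Rightarrow> ('a set \<times> 'a set) set" where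
  "links E \<B> = {(X, Y). X \<in> \<B> \<and> Y \<in> \<B> \<and> X \<noteq> Y \<and> touching E X Y}"

definition complete_model :: "'a ugraph \<Rightarrow> nat \<Rightarrow> (nat \<Rightarrow> 'a set) \<Rightarrow> bool" where
  "complete_model G t B \<longleftrightarrow>
     (\<forall>i<t. B i \<noteq> {} \<and> B i \<subseteq> verts G \<and> connected_in (edges G) (B i)) \<and>
     (\<forall>i<t. \<forall>j<t. i \<noteq> j \<longrightarrow> B i \<inter> B j = {} \<and> touching (edges G) (B i) (B j))"

lemma finite_links: "finite \<B> \<Longrightarrow> finite (links E \<B>)"
  by (rule finite_subset[of _ "\<B> \<times> \<B>"]) (auto simp: links_def)

lemma branch_family_subset: "branch_family G \<B> \<Longrightarrow> \<C> \<subseteq> \<B> \<Longrightarrow> branch_family G \<C>"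
  unfolding branch_family_def by (meson finite_subset pairwise_subset subset_iff)

text \<open>Contracting the edge between \<open>X\<close> and \<open>Y\<close> loses this edge and
  one of two parallel edges for every common neighbour, each counted twice.\<close>

lemma branch_family_merge:
  assumes B: "branch_family G \<B>" and XY: "(X, Y) \<in> links (edges G) \<B>"
  shows "branch_family G (insert (X \<union> Y) (\<B> - {X, Y}))"
    and "card (insert (X \<union> Y) (\<B> - {X, Y})) = card \<B> - 1"
    and "card (links (edges G) \<B>) \<le> card (links (edges G) (insert (X \<union> Y) (\<B> - {X, Y}))) +
      2 * card {Z \<in> \<B>. (X, Z) \<in> links (edges G) \<B> \<and> (Y, Z) \<in> links (edges G) \<B>} + 2"
proof -
  let ?E = "edges G"
  define R where "R = \<B> - {X, Y}"
  define a where "a W = {Z \<in> R. touching ?E W Z}" for W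
  have fin: "finite \<B>" "finite R" "\<And>W. finite (a W)"
    using B by (auto simp: branch_family_def R_def a_def)
  have X: "X \<in> \<B>" "Y \<in> \<B>" "X \<noteq> Y" "touching ?E X Y"
    using XY by (auto simp: links_def)
  have disj: "Z \<inter> W = {}" if "Z \<in> \<B>" "W \<in> \<B>" "Z \<noteq> W" for Z W
    using B that unfolding branch_family_def by (metis disjnt_def pairwiseD)
  have ne: "X \<noteq> {}" "Y \<noteq> {}"
    using B X by (auto simp: branch_family_def)
  have notin: "X \<union> Y \<notin> \<B>"
    using disj[of "X \<union> Y" X] disj[of "X \<union> Y" Y] X ne by blast
  have dR: "(X \<union> Y) \<inter> Z = {}" if "Z \<in> R" for Z
    using that disj[of X Z] disj[of Y Z] X by (auto simp: R_def)
  have "disjoint R"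
    using B unfolding branch_family_def R_def by (meson Diff_subset pairwise_subset)
  then have "disjoint (insert (X \<union> Y) R)"
    using dR by (auto simp: pairwise_insert disjnt_def)
  then show "branch_family G (insert (X \<union> Y) (\<B> - {X, Y}))"
    using B X connected_in_Un[of ?E X Y] ne unfolding branch_family_def R_def[symmetric]
    by (simp add: fin) (auto simp: R_def)
  have cR: "card R = card \<B> - 2"
    using X fin by (simp add: R_def card_Diff_subset)
  have "card {X, Y} \<le> card \<B>"
    using X fin by (intro card_mono) auto
  then show "card (insert (X \<union> Y) (\<B> - {X, Y})) = card \<B> - 1"
    using notin fin cR X unfolding R_def by (subst card_insert_disjoint) auto
  have "links ?E \<B> \<subseteq> links ?E R \<union> {X} \<times> a X \<union> a X \<times> {X} \<union> {Y} \<times> a Y \<union> a Y \<times> {Y} \<union> {(X, Y), (Y, X)}"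
  proof (rule subrelI)
    fix P Q assume "(P, Q) \<in> links ?E \<B>"
    then have "P \<in> \<B>" "Q \<in> \<B>" "P \<noteq> Q" "touching ?E P Q" "touching ?E Q P"
      using touching_commute by (auto simp: links_def)
    then show "(P, Q) \<in> links ?E R \<union> {X} \<times> a X \<union> a X \<times> {X} \<union> {Y} \<times> a Y \<union> a Y \<times> {Y} \<union> {(X, Y), (Y, X)}"
      by (cases "P = X"; cases "P = Y"; cases "Q = X"; cases "Q = Y") (simp_all add: links_def a_def R_def)
  qed
  then have "card (links ?E \<B>) \<le>
      card (links ?E R \<union> {X} \<times> a X \<union> a X \<times> {X} \<union> {Y} \<times> a Y \<union> a Y \<times> {Y} \<union> {(X, Y), (Y, X)})"
    using fin by (intro card_mono) (auto simp: finite_links)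
  also have "\<dots> \<le> card (links ?E R) + card (a X) + card (a X) + card (a Y) + card (a Y) + 2"
  proof -
    have un: "card (A \<union> B) \<le> p + q" if "card A \<le> p" "card B \<le> q" for A B :: "('a set \<times> 'a set) set" and p q
      using card_Un_le[of A B] that by linarith
    have "card ({W} \<times> a W) \<le> card (a W)" "card (a W \<times> {W}) \<le> card (a W)" for W
      by (simp_all add: card_cartesian_product)
    moreover have "card {(X, Y), (Y, X)} \<le> 2"
      using card_length[of "[(X, Y), (Y, X)]"] by simp
    ultimately show ?thesis
      using un[OF un[OF un[OF un[OF un[OF order_refl]]]]] by blast
  qed
  finally have 1: "card (links ?E \<B>) \<le> card (links ?E R) + 2 * card (a X) + 2 * card (a Y) + 2"
    by simp
  let ?A = "a X \<union> a Y"
  have RB: "X \<union> Y \<notin> R" using notin by (auto simp: R_def)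
  have "links ?E R \<union> {X \<union> Y} \<times> ?A \<union> ?A \<times> {X \<union> Y} \<subseteq> links ?E (insert (X \<union> Y) R)"
  proof -
    have "touching ?E (X \<union> Y) Z" "touching ?E Z (X \<union> Y)" "Z \<in> R" "Z \<noteq> X \<union> Y" if "Z \<in> ?A" for Z
      using that RB touching_commute[of ?E Z "X \<union> Y"] by (auto simp: a_def touching_Un)
    moreover have "links ?E R \<subseteq> links ?E (insert (X \<union> Y) R)" by (auto simp: links_def)
    ultimately show ?thesis by (auto simp: links_def)
  qed
  then have "card (links ?E R \<union> {X \<union> Y} \<times> ?A \<union> ?A \<times> {X \<union> Y}) \<le> card (links ?E (insert (X \<union> Y) R))"
    using fin by (intro card_mono) (auto simp: finite_links)
  moreover have "card (links ?E R \<union> {X \<union> Y} \<times> ?A \<union> ?A \<times> {X \<union> Y}) =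
      card (links ?E R) + card ?A + card ?A"
    using fin RB
    by (subst card_Un_disjoint, simp add: finite_links, simp, force simp: a_def links_def)+
       (simp add: card_cartesian_product)
  ultimately have 2: "card (links ?E R) + 2 * card ?A \<le> card (links ?E (insert (X \<union> Y) R))"
    by simp
  have 3: "card (a X) + card (a Y) = card ?A + card (a X \<inter> a Y)"
    using fin card_Un_Int by blast
  have 4: "card (a X \<inter> a Y) \<le> card {Z \<in> \<B>. (X, Z) \<in> links ?E \<B> \<and> (Y, Z) \<in> links ?E \<B>}"
    using fin X by (intro card_mono) (auto simp: a_def links_def R_def)
  show "card (links ?E \<B>) \<le> card (links ?E (insert (X \<union> Y) (\<B> - {X, Y}))) +
      2 * card {Z \<in> \<B>. (X, Z) \<in> links ?E \<B> \<and> (Y, Z) \<in> links ?E \<B>} + 2"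
    using 1 2 3 4 unfolding R_def by linarith
qed

text \<open>Mader's argument. Take a coarsening with fewest members that is still dense. Contracting
  one of its edges must lose many links, so adjacent members have many common neighbours. Hence the
  neighbours of a fixed member \<open>X\<close> are dense among themselves, contain a complete model
  with one branch set less, and \<open>X\<close> completes it. The factor solves a(0) = 0, a(t+1) =
  2 a(t) + 2.\<close>

lemma dense_family_complete_model:
  assumes "branch_family G \<B>" "\<B> \<noteq> {}"
    and "(2 ^ Suc t - 2) * card \<B> \<le> card (links (edges G) \<B>)"
  shows "\<exists>B. complete_model G t B \<and> (\<forall>i<t. B i \<subseteq> \<Union>\<B> \<and> (\<exists>X\<in>\<B>. X \<subseteq> B i))"
  using assms
proof (induction t arbitrary: \<B>)
  case 0
  then show ?case by (auto simp: complete_model_def)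
next
  case (Suc t)
  let ?E = "edges G"
  define c where "c = (2 ^ Suc t - 2 :: nat)"
  have c2: "2 ^ Suc (Suc t) - 2 = 2 * c + (2::nat)"
  proof -
    have "(2::nat) ^ Suc t \<ge> 2" by simp
    then show ?thesis unfolding c_def power_Suc by linarith
  qed
  \<comment> \<open>The last clause is carried over to the conclusion. In the induction step it
    ensures that a branch set found among the neighbours of \<open>X\<close> contains a whole
    neighbour and so touches \<open>X\<close>.\<close>
  define coarse where "coarse \<C> \<longleftrightarrow> branch_family G \<C> \<and> \<C> \<noteq> {} \<and>
      (2 * c + 2) * card \<C> \<le> card (links ?E \<C>) \<and> \<Union>\<C> \<subseteq> \<Union>\<B> \<and> (\<forall>Y\<in>\<C>. \<exists>X\<in>\<B>. X \<subseteq> Y)" for \<C>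
  have "coarse \<B>" using Suc.prems c2 by (auto simp: coarse_def)
  then obtain \<C> where C: "coarse \<C>" and min: "\<And>\<D>. coarse \<D> \<Longrightarrow> card \<C> \<le> card \<D>"
    using ex_has_least_nat[of coarse \<B> card] by blast
  have fam: "branch_family G \<C>" and fin: "finite \<C>" and ne: "\<C> \<noteq> {}"
    and dense: "(2 * c + 2) * card \<C> \<le> card (links ?E \<C>)"
    using C by (auto simp: coarse_def branch_family_def)
  have "card \<C> > 0" using fin ne by (simp add: card_gt_0_iff)
  then have "card (links ?E \<C>) > 0" using dense by (metis add_gr_0 nat_0_less_mult_iff order_less_le_trans zero_less_numeral)
  then obtain X Y0 where XY0: "(X, Y0) \<in> links ?E \<C>"
    by (metis card.empty ex_in_conv less_numeral_extra(3) prod.exhaust)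
  define N where "N = {Y \<in> \<C>. (X, Y) \<in> links ?E \<C>}"
  have NC: "N \<subseteq> \<C>" and finN: "finite N" using fin by (auto simp: N_def)
  have X: "X \<in> \<C>" "X \<notin> N" using XY0 by (auto simp: links_def N_def)
  have common: "c \<le> card {Z \<in> N. (Y, Z) \<in> links ?E N}" if Y: "Y \<in> N" for Y
  proof -
    let ?D = "insert (X \<union> Y) (\<C> - {X, Y})"
    have XY: "(X, Y) \<in> links ?E \<C>" using Y by (simp add: N_def)
    note m = branch_family_merge[OF fam XY]
    have YC: "Y \<in> \<C>" using XY by (auto simp: links_def)
    \<comment> \<open>The merged family has one member less, so by minimality it is not coarse, and
      density is the only clause that can fail.\<close>
    have "\<not> coarse ?D"
      using min[of ?D] m(2) \<open>card \<C> > 0\<close> by linarith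
    moreover have "\<Union>?D = \<Union>\<C>" using X(1) YC by blast
    moreover have "\<exists>W\<in>\<B>. W \<subseteq> V" if "V \<in> ?D" for V
    proof -
      have "\<exists>V'\<in>\<C>. V' \<subseteq> V" using that X(1) by blast
      then show ?thesis using C unfolding coarse_def by (meson order_trans)
    qed
    ultimately have "\<not> (2 * c + 2) * card ?D \<le> card (links ?E ?D)"
      using m(1) C unfolding coarse_def by (metis insert_not_empty)
    then have "card (links ?E ?D) < (2 * c + 2) * (card \<C> - 1)"
      using m(2) by simp
    moreover have "(2 * c + 2) * card \<C> = (2 * c + 2) * (card \<C> - 1) + (2 * c + 2)"
      using \<open>card \<C> > 0\<close> by (cases "card \<C>") auto
    ultimately have "c \<le> card {Z \<in> \<C>. (X, Z) \<in> links ?E \<C> \<and> (Y, Z) \<in> links ?E \<C>}"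
      using m(3) dense by linarith
    also have "{Z \<in> \<C>. (X, Z) \<in> links ?E \<C> \<and> (Y, Z) \<in> links ?E \<C>} = {Z \<in> N. (Y, Z) \<in> links ?E N}"
      using Y by (auto simp: N_def links_def)
    finally show ?thesis .
  qed
  have "c * card N = (\<Sum>Y\<in>N. c)" by simp
  also have "\<dots> \<le> (\<Sum>Y\<in>N. card {Z \<in> N. (Y, Z) \<in> links ?E N})"
    using common by (rule sum_mono)
  also have "\<dots> = card (SIGMA Y:N. {Z \<in> N. (Y, Z) \<in> links ?E N})"
    using finN by simp
  also have "(SIGMA Y:N. {Z \<in> N. (Y, Z) \<in> links ?E N}) = links ?E N"
    by (auto simp: links_def)
  finally have "(2 ^ Suc t - 2) * card N \<le> card (links ?E N)"
    by (simp add: c_def)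
  moreover have "N \<noteq> {}" using XY0 by (auto simp: N_def links_def)
  ultimately obtain B where B: "complete_model G t B" "\<And>i. i < t \<Longrightarrow> B i \<subseteq> \<Union>N"
    "\<And>i. i < t \<Longrightarrow> \<exists>Y\<in>N. Y \<subseteq> B i"
    using Suc.IH[OF branch_family_subset[OF fam NC]] by metis
  have XB: "X \<inter> B i = {}" "touching ?E X (B i)" if "i < t" for i
  proof -
    have "X \<inter> Y = {}" if "Y \<in> N" for Y
      using fam X that NC unfolding branch_family_def by (metis disjnt_def pairwiseD subsetD)
    then show "X \<inter> B i = {}" using B(2)[OF that] by blast
    show "touching ?E X (B i)"
      using B(3)[OF that] by (auto simp: N_def links_def touching_def)
  qed
  have BX: "B i \<inter> X = {}" "touching ?E (B i) X" if "i < t" for i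
    using XB[OF that] by (auto simp: touching_commute)
  have Xok: "X \<noteq> {}" "X \<subseteq> verts G" "connected_in ?E X"
    using fam X by (auto simp: branch_family_def)
  have "complete_model G (Suc t) (B(t := X))"
    using B(1) XB BX Xok unfolding complete_model_def by (auto simp: less_Suc_eq)
  moreover have "(B(t := X)) i \<subseteq> \<Union>\<B> \<and> (\<exists>Y\<in>\<B>. Y \<subseteq> (B(t := X)) i)" if "i < Suc t" for i
  proof (cases "i = t")
    case True
    then show ?thesis using C X unfolding coarse_def by auto
  next
    case False
    then have "i < t" using that by simp
    have "\<Union>N \<subseteq> \<Union>\<B>" using NC C unfolding coarse_def by blast
    moreover obtain Y where "Y \<in> N" "Y \<subseteq> B i" using B(3)[OF \<open>i < t\<close>] by blast
    moreover have "\<exists>Z\<in>\<B>. Z \<subseteq> Y" using \<open>Y \<in> N\<close> NC C unfolding coarse_def by blast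
    ultimately show ?thesis using B(2)[OF \<open>i < t\<close>] False by (auto; blast)
  qed
  ultimately show ?case by blast
qed

section \<open>From models of complete graphs to minors\<close>

lemma simple_graph_edgeD:
  assumes "simple_graph G" "{a, b} \<in> edges G"
  shows "a \<noteq> b" "a \<in> verts G" "b \<in> verts G"
proof -
  have "card {a, b} = 2" "{a, b} \<subseteq> verts G"
    using assms unfolding simple_graph_def by blast+
  then show "a \<noteq> b" "a \<in> verts G" "b \<in> verts G"
    by (auto simp: card_insert_if split: if_splits)
qed

lemma simple_graph_contract_edge:
  assumes G: "simple_graph G" and uv: "{u, v} \<in> edges G"
  shows "simple_graph (contract_edge G u v)"
proof -
  note e = simple_graph_edgeD[OF G]
  have "e \<subseteq> verts G - {v} \<and> card e = 2" if "e \<in> edges (contract_edge G u v)" for e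
  proof (cases "e \<in> edges G \<and> v \<notin> e")
    case True
    then show ?thesis using G by (auto simp: simple_graph_def)
  next
    case False
    then have "e \<in> {{u, w} |w. {v, w} \<in> edges G \<and> w \<noteq> u}"
      using that by (auto simp: contract_edge_def)
    then obtain w where "e = {u, w}" "{v, w} \<in> edges G" "w \<noteq> u"
      by blast
    then show ?thesis using e[OF uv] e[of v w] by auto
  qed
  then show ?thesis using G by (auto simp: simple_graph_def contract_edge_def)
qed

lemma simple_graph_delete_vertex: "simple_graph G \<Longrightarrow> simple_graph (delete_vertex G v)"
  by (auto simp: simple_graph_def delete_vertex_def)

text \<open>\<open>id(v := u)\<close> is the quotient map of the contraction; walks and branch sets
  are pushed forward along it below.\<close>

lemma contract_edge_edgeI:
  assumes G: "simple_graph G" and ab: "{a, b} \<in> edges G" "(id(v := u)) a \<noteq> (id(v := u)) b"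
  shows "{(id(v := u)) a, (id(v := u)) b} \<in> edges (contract_edge G u v)"
  using ab simple_graph_edgeD[OF G ab(1)]
  by (auto simp: contract_edge_def insert_commute split: if_splits)

lemma connected_in_contract_edge:
  assumes G: "simple_graph G" and X: "connected_in (edges G) X"
  shows "connected_in (edges (contract_edge G u v)) (id(v := u) ` X)"
proof -
  let ?f = "id(v := u)"
  let ?E = "edges (contract_edge G u v)"
  have "(?f x, ?f y) \<in> {(a, b). {a, b} \<in> ?E \<and> a \<in> ?f ` X \<and> b \<in> ?f ` X}\<^sup>*"
    if "(x, y) \<in> {(a, b). {a, b} \<in> edges G \<and> a \<in> X \<and> b \<in> X}\<^sup>*" for x y
    using that
  proof induction
    case (step y z)
    show ?case
    proof (cases "?f y = ?f z")
      case True
      show ?thesis using step.IH unfolding True .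
    next
      case False
      have "{y, z} \<in> edges G" "y \<in> X" "z \<in> X" using step.hyps by auto
      then have "(?f y, ?f z) \<in> {(a, b). {a, b} \<in> ?E \<and> a \<in> ?f ` X \<and> b \<in> ?f ` X}"
        using contract_edge_edgeI[OF G _ False] by blast
      then show ?thesis using step.IH by (rule rtrancl_into_rtrancl[rotated])
    qed
  qed (rule rtrancl_refl)
  then show ?thesis using X unfolding connected_in_def by blast
qed

lemma connected_in_edge:
  assumes "connected_in E X" "x \<in> X" "y \<in> X" "x \<noteq> y"
  shows "\<exists>u\<in>X. \<exists>v\<in>X. {u, v} \<in> E"
proof -
  have "(x, y) \<in> {(a, b). {a, b} \<in> E \<and> a \<in> X \<and> b \<in> X}\<^sup>*"
    using assms by (auto simp: connected_in_def)
  then show ?thesis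
  proof (cases rule: converse_rtranclE)
    case base
    then show ?thesis using assms(4) by simp
  next
    case (step z)
    then show ?thesis by blast
  qed
qed

text \<open>As the edge lies inside one branch set, the quotient map sends every branch set into
  itself, and disjointness is inherited.\<close>

lemma complete_model_contract_edge:
  assumes G: "simple_graph G" and B: "complete_model G t B"
    and uv: "{u, v} \<in> edges G" "u \<in> B i" "v \<in> B i" "i < t"
  shows "complete_model (contract_edge G u v) t (\<lambda>j. id(v := u) ` B j)"
proof -
  let ?f = "id(v := u)"
  have sub: "?f ` B j \<subseteq> B j" if "j < t" for j
  proof (cases "j = i")
    case False
    then have "B j \<inter> B i = {}" using B that uv by (auto simp: complete_model_def)
    then show ?thesis using uv by auto
  qed (use uv in auto)
  have disj: "?f ` B j \<inter> ?f ` B l = {}" if "j < t" "l < t" "j \<noteq> l" for j l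
    using sub[OF that(1)] sub[OF that(2)] B that unfolding complete_model_def by blast
  have touch: "touching (edges (contract_edge G u v)) (?f ` B j) (?f ` B l)"
    if jl: "j < t" "l < t" "j \<noteq> l" for j l
  proof -
    obtain x y where xy: "x \<in> B j" "y \<in> B l" "{x, y} \<in> edges G"
      using B jl unfolding complete_model_def touching_def by blast
    then have "?f x \<noteq> ?f y" using disj[OF jl] by blast
    then show ?thesis using contract_edge_edgeI[OF G xy(3)] xy(1,2) unfolding touching_def by blast
  qed
  have "?f ` B j \<subseteq> verts (contract_edge G u v)" if "j < t" for j
  proof -
    have "?f ` B j \<subseteq> verts G" using sub[OF that] B that unfolding complete_model_def by blast
    moreover have "v \<notin> ?f ` B j" using simple_graph_edgeD(1)[OF G uv(1)] by auto
    ultimately show ?thesis by (auto simp: contract_edge_def)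
  qed
  moreover have "?f ` B j \<noteq> {}" "connected_in (edges (contract_edge G u v)) (?f ` B j)" if "j < t" for j
    using B that connected_in_contract_edge[OF G] by (auto simp: complete_model_def)
  ultimately show ?thesis
    using disj touch unfolding complete_model_def by auto
qed

lemma complete_model_delete_vertex:
  assumes B: "complete_model G t B" and v: "\<And>i. i < t \<Longrightarrow> v \<notin> B i"
  shows "complete_model (delete_vertex G v) t B"
proof -
  have "connected_in (edges (delete_vertex G v)) (B i)" if "i < t" for i
  proof -
    have "{(a, b). {a, b} \<in> edges G \<and> a \<in> B i \<and> b \<in> B i} =
        {(a, b). {a, b} \<in> edges (delete_vertex G v) \<and> a \<in> B i \<and> b \<in> B i}"
      using v[OF that] by (auto simp: delete_vertex_def)
    moreover have "connected_in (edges G) (B i)" using B that by (simp add: complete_model_def)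
    ultimately show ?thesis by (simp only: connected_in_def)
  qed
  moreover have "touching (edges (delete_vertex G v)) (B i) (B j)" if "i < t" "j < t" "i \<noteq> j" for i j
    using B that v[OF that(1)] v[OF that(2)]
    unfolding complete_model_def touching_def delete_vertex_def by fastforce
  moreover have "B i \<noteq> {}" "B i \<subseteq> verts (delete_vertex G v)" if "i < t" for i
    using B that v[OF that] unfolding complete_model_def delete_vertex_def by auto
  ultimately show ?thesis using B unfolding complete_model_def by blast
qed

definition complete_ugraph :: "'a ugraph \<Rightarrow> bool" where
  "complete_ugraph K \<longleftrightarrow> (\<forall>x\<in>verts K. \<forall>y\<in>verts K. x \<noteq> y \<longrightarrow> {x, y} \<in> edges K)"

text \<open>Delete a vertex outside all branch sets or contract an edge inside one of them; both
  lower the number of vertices. When neither is possible, connectedness makes the branch sets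
  singletons that exhaust the vertices, and the graph itself is complete.\<close>

lemma complete_model_minor:
  assumes "simple_graph G" "complete_model G t B"
  shows "\<exists>K. minor_step\<^sup>*\<^sup>* G K \<and> simple_graph K \<and> card (verts K) = t \<and> complete_ugraph K"
  using assms
proof (induction "card (verts G)" arbitrary: G B rule: less_induct)
  case less
  note G = less.prems(1) and B = less.prems(2)
  have fin: "finite (verts G)" using G by (simp add: simple_graph_def)
  have rec: ?case if "minor_step G G'" "simple_graph G'" "complete_model G' t B'"
      "verts G' = verts G - {v}" "v \<in> verts G" for G' B' v
  proof -
    have "card (verts G') < card (verts G)"
      using that(4,5) fin by (metis card_Diff1_less)
    then show ?thesis
      using less.hyps[OF _ that(2,3)] that(1) by (meson converse_rtranclp_into_rtranclp)
  qed
  show ?case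
  proof (cases "\<exists>v\<in>verts G. \<forall>i<t. v \<notin> B i")
    case True
    then obtain v where v: "v \<in> verts G" "\<And>i. i < t \<Longrightarrow> v \<notin> B i" by blast
    show ?thesis
      by (rule rec[OF minor_step.vertex_deletion[OF v(1)] simple_graph_delete_vertex[OF G]
            complete_model_delete_vertex[OF B v(2)] _ v(1)]) (auto simp: delete_vertex_def)
  next
    case covered: False
    show ?thesis
    proof (cases "\<exists>i<t. \<exists>u\<in>B i. \<exists>v\<in>B i. {u, v} \<in> edges G")
      case True
      then obtain i u v where uv: "{u, v} \<in> edges G" "u \<in> B i" "v \<in> B i" "i < t" by blast
      show ?thesis
        by (rule rec[OF minor_step.edge_contraction[OF uv(1)] simple_graph_contract_edge[OF G uv(1)]
              complete_model_contract_edge[OF G B uv] _ simple_graph_edgeD(3)[OF G uv(1)]])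
          (simp add: contract_edge_def)
  next
    case False
    then have single: "\<forall>i<t. \<forall>x\<in>B i. \<forall>y\<in>B i. x = y"
      using B connected_in_edge unfolding complete_model_def by meson
    have "\<forall>i<t. \<exists>x. B i = {x}" using B single unfolding complete_model_def by blast
    then obtain g where g: "\<And>i. i < t \<Longrightarrow> B i = {g i}" by metis
    have "inj_on g {..<t}"
    proof (rule inj_onI)
      fix i j assume "i \<in> {..<t}" "j \<in> {..<t}" "g i = g j"
      then have "i < t" "j < t" "B i \<inter> B j \<noteq> {}" using g[of i] g[of j] by auto
      then show "i = j" using B unfolding complete_model_def by blast
    qed
    moreover have vG: "verts G = g ` {..<t}"
    proof
      show "verts G \<subseteq> g ` {..<t}" using covered g by fastforce
      show "g ` {..<t} \<subseteq> verts G" using B g unfolding complete_model_def by fastforce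
    qed
    ultimately have "card (verts G) = t" by (simp add: card_image)
    moreover have "{x, y} \<in> edges G" if "x \<in> verts G" "y \<in> verts G" "x \<noteq> y" for x y
    proof -
      have "x \<in> g ` {..<t}" "y \<in> g ` {..<t}" using that(1,2) unfolding vG .
      then obtain i j where ij: "i < t" "j < t" "x = g i" "y = g j" by blast
      then have "i \<noteq> j" using that(3) by blast
      then have "touching (edges G) (B i) (B j)"
        using B ij(1,2) unfolding complete_model_def by simp
      then show ?thesis using g ij unfolding touching_def by auto
    qed
    ultimately show ?thesis using G unfolding complete_ugraph_def by blast
    qed
  qed
qed

lemma minor_steps_delete_edges:
  assumes "finite F" "F \<subseteq> edges G"
  shows "minor_step\<^sup>*\<^sup>* G (delete_edges G F)"
  using assms
proof (induction F rule: finite_induct)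
  case empty
  have "delete_edges G {} = G" by (simp add: delete_edges_def)
  then show ?case by simp
next
  case (insert e F)
  have "minor_step (delete_edges G F) (delete_edges (delete_edges G F) {e})"
    using insert by (intro minor_step.edge_deletion) (auto simp: delete_edges_def)
  moreover have "delete_edges (delete_edges G F) {e} = delete_edges G (insert e F)"
    by (auto simp: delete_edges_def)
  moreover have "minor_step\<^sup>*\<^sup>* G (delete_edges G F)" using insert by simp
  ultimately show ?case by (simp add: rtranclp.rtrancl_into_rtrancl)
qed

text \<open>Any bijection of the vertices will do: the edges that it does not send to edges of
  \<open>L\<close> are deleted.\<close>

lemma complete_ugraph_has_minor:
  assumes K: "simple_graph K" "complete_ugraph K" and L: "simple_graph L" "card (verts L) = card (verts K)"
  shows "has_minor K L"
proof -
  have fin: "finite (verts K)" "finite (verts L)" using K L by (auto simp: simple_graph_def)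
  then obtain \<phi> where \<phi>: "bij_betw \<phi> (verts K) (verts L)"
    using L(2) finite_same_card_bij by metis
  define F where "F = {e \<in> edges K. \<phi> ` e \<notin> edges L}"
  have "finite (edges K)"
    using K fin by (intro finite_subset[of "edges K" "Pow (verts K)"]) (auto simp: simple_graph_def)
  then have "minor_step\<^sup>*\<^sup>* K (delete_edges K F)"
    by (intro minor_steps_delete_edges) (auto simp: F_def)
  moreover have "edges L \<subseteq> (\<lambda>e. \<phi> ` e) ` edges (delete_edges K F)"
  proof
    fix e assume e: "e \<in> edges L"
    then obtain a b where ab: "e = {a, b}" "a \<noteq> b" "a \<in> verts L" "b \<in> verts L"
      using L(1) unfolding simple_graph_def by (metis card_2_iff insert_subset)
    then obtain x y where xy: "x \<in> verts K" "y \<in> verts K" "a = \<phi> x" "b = \<phi> y"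
      using \<phi> unfolding bij_betw_def by blast
    have "x \<noteq> y" using ab(2) xy(3,4) by auto
    then have "{x, y} \<in> edges K" using K(2) xy(1,2) unfolding complete_ugraph_def by simp
    moreover have "\<phi> ` {x, y} = e" using ab xy by auto
    ultimately show "e \<in> (\<lambda>e. \<phi> ` e) ` edges (delete_edges K F)"
      using e by (intro image_eqI[of _ _ "{x, y}"]) (simp_all add: delete_edges_def F_def)
  qed
  then have "graph_iso (delete_edges K F) L"
    unfolding graph_iso_def using \<phi> by (intro exI[of _ \<phi>]) (auto simp: delete_edges_def F_def)
  ultimately show ?thesis unfolding has_minor_def by blast
qed

text \<open>A complete minor on \<open>card (verts L)\<close> vertices would yield \<open>L\<close>.
  All branch families are covered, not only singletons, because the counting of pairs takes place in
  minors.\<close>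

lemma minor_free_links:
  assumes G: "simple_graph G" "minor_free G L" and L: "simple_graph L"
    and fam: "branch_family G \<B>"
  shows "card (links (edges G) \<B>) \<le> 2 ^ Suc (card (verts L)) * card \<B>"
proof (rule ccontr)
  assume "\<not> ?thesis"
  then have less: "2 ^ Suc (card (verts L)) * card \<B> < card (links (edges G) \<B>)" by simp
  moreover have "(2 ^ Suc (card (verts L)) - 2) * card \<B> \<le> 2 ^ Suc (card (verts L)) * card \<B>" by simp
  ultimately have "(2 ^ Suc (card (verts L)) - 2) * card \<B> \<le> card (links (edges G) \<B>)" by linarith
  moreover have "\<B> \<noteq> {}" using less by (auto simp: links_def)
  ultimately obtain B where "complete_model G (card (verts L)) B"
    using dense_family_complete_model[OF fam] by blast
  then obtain K where K: "minor_step\<^sup>*\<^sup>* G K" "simple_graph K" "card (verts K) = card (verts L)" "complete_ugraph K"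
    using complete_model_minor[OF G(1)] by blast
  then have "has_minor K L" using complete_ugraph_has_minor L by metis
  then have "has_minor G L" using K(1) unfolding has_minor_def by (meson rtranclp_trans)
  then show False using G(2) by (simp add: minor_free_def)
qed

section \<open>Coherent packings of copies\<close>

definition deg :: "'a ugraph \<Rightarrow> 'a \<Rightarrow> nat" where
  "deg G v = card (neighbors G v)"

text \<open>The vertices \<open>{..<k}\<close> of a pattern are eliminated in increasing order: \<open>branch F i\<close> is the
  component of \<open>i\<close> in the pattern induced on \<open>{..i}\<close>, and \<open>upper F i\<close> are the higher neighbours of
  \<open>i\<close> in the resulting chordal completion.\<close>

definition branch :: "nat set set \<Rightarrow> nat \<Rightarrow> nat set" where
  "branch F i = {x. (i, x) \<in> {(a, b). {a, b} \<in> F \<and> a \<le> i \<and> b \<le> i}\<^sup>*}"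

definition upper :: "nat set set \<Rightarrow> nat \<Rightarrow> nat set" where
  "upper F i = {j. i < j \<and> (\<exists>x\<in>branch F i. {x, j} \<in> F)}"

definition coherent :: "(nat \<Rightarrow> 'a) set \<Rightarrow> nat \<Rightarrow> nat \<Rightarrow> bool" where
  "coherent Q i j \<longleftrightarrow> (\<forall>\<phi>\<in>Q. \<forall>\<psi>\<in>Q. \<phi> i = \<psi> i \<longrightarrow> \<phi> j = \<psi> j)"

lemma coherent_subset: "coherent Q i j \<Longrightarrow> Q' \<subseteq> Q \<Longrightarrow> coherent Q' i j"
  by (auto simp: coherent_def)

text \<open>Average degree at most \<open>C\<close> in every graph that arises by contracting
  disjoint connected sets and dropping the remaining vertices. From here on, minor-freeness enters
  in this form only.\<close>

definition sparse_minors :: "nat \<Rightarrow> 'a ugraph \<Rightarrow> bool" where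
  "sparse_minors C G \<longleftrightarrow>
     (\<forall>\<B>. branch_family G \<B> \<longrightarrow> card (links (edges G) \<B>) \<le> C * card \<B>)"

lemma branch_refl: "i \<in> branch F i"
  by (simp add: branch_def)

lemma branch_le: "x \<in> branch F i \<Longrightarrow> x \<le> i"
proof -
  assume "x \<in> branch F i"
  then have "(i, x) \<in> {(a, b). {a, b} \<in> F \<and> a \<le> i \<and> b \<le> i}\<^sup>*" by (simp add: branch_def)
  then show "x \<le> i" by induction auto
qed

lemma branch_step: "x \<in> branch F i \<Longrightarrow> {x, y} \<in> F \<Longrightarrow> y \<le> i \<Longrightarrow> y \<in> branch F i"
  using branch_le[of x F i] unfolding branch_def
  by (auto intro: rtrancl_into_rtrancl)

lemma branch_subset:
  assumes "x \<in> branch F i"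
  shows "branch F x \<subseteq> branch F i"
proof
  fix y assume "y \<in> branch F x"
  then have "(x, y) \<in> {(a, b). {a, b} \<in> F \<and> a \<le> x \<and> b \<le> x}\<^sup>*" by (simp add: branch_def)
  then show "y \<in> branch F i"
  proof induction
    case (step y z)
    then show ?case using branch_step[of y F i z] branch_le[OF assms] by auto
  qed (rule assms)
qed

lemma rtrancl_edges_sym:
  assumes "(x, y) \<in> {(a, b). {a, b} \<in> E \<and> P a \<and> P b}\<^sup>*"
  shows "(y, x) \<in> {(a, b). {a, b} \<in> E \<and> P a \<and> P b}\<^sup>*"
proof -
  have "sym {(a, b). {a, b} \<in> E \<and> P a \<and> P b}"
    by (auto simp: sym_def insert_commute)
  then show ?thesis using assms by (meson symD sym_rtrancl)
qed

text \<open>On a path from \<open>x\<close> to \<open>i\<close> inside \<open>{..i}\<close>, the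
  first vertex above \<open>x\<close> is adjacent to \<open>branch F x\<close>. Repeating this
  climbs from \<open>x\<close> to its ancestor \<open>i\<close> in the elimination tree.\<close>

lemma branch_upper:
  assumes "x \<in> branch F i" "x \<noteq> i"
  shows "\<exists>y\<in>upper F x. y \<in> branch F i"
proof -
  have "(i, x) \<in> {(a, b). {a, b} \<in> F \<and> a \<le> i \<and> b \<le> i}\<^sup>*"
    using assms by (simp add: branch_def)
  then have "(x, i) \<in> {(a, b). {a, b} \<in> F \<and> a \<le> i \<and> b \<le> i}\<^sup>*"
    by (rule rtrancl_edges_sym)
  moreover have "z \<in> branch F x \<or> (\<exists>y\<in>upper F x. y \<in> branch F i)"
    if "(x, z) \<in> {(a, b). {a, b} \<in> F \<and> a \<le> i \<and> b \<le> i}\<^sup>*" for z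
    using that
  proof induction
    case base
    then show ?case by (simp add: branch_refl)
  next
    case (step y z)
    then have yz: "{y, z} \<in> F" "y \<le> i" "z \<le> i" by auto
    show ?case
    proof (cases "\<exists>y\<in>upper F x. y \<in> branch F i")
      case False
      then have y: "y \<in> branch F x" using step.IH by blast
      then have z: "z \<in> branch F i"
        using branch_subset[OF assms(1)] branch_step yz by blast
      have "z \<le> x"
      proof (rule ccontr)
        assume "\<not> z \<le> x"
        then have "z \<in> upper F x" using y yz(1) by (auto simp: upper_def)
        then show False using False z by blast
      qed
      then show ?thesis using branch_step[OF y yz(1)] by blast
    qed blast
  qed
  moreover have "i \<notin> branch F x"
    using branch_le[of i F x] branch_le[OF assms(1)] assms(2) by auto
  ultimately show ?thesis by meson
qed

section \<open>Edge-disjoint coloured copies of a pattern\<close>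

text \<open>By \<open>colored\<close> a vertex has at most one colour. With
  \<open>\<phi> = \<psi>\<close> this makes the maps injective on the colours, and it allows
  \<open>edge_disjoint\<close> to compare equal positions only. The bound \<open>2 \<le> k\<close>
  gives every colour a neighbour in the pattern.\<close>

locale packing =
  fixes G :: "'a ugraph" and k :: nat and F :: "nat set set" and Q :: "(nat \<Rightarrow> 'a) set"
  assumes simple: "simple_graph G"
    and pattern: "simple_graph \<lparr>verts = {..<k}, edges = F\<rparr>" "connected_in F {..<k}" "2 \<le> k"
    and finite_Q: "finite Q"
    and maps: "\<phi> \<in> Q \<Longrightarrow> i < k \<Longrightarrow> \<phi> i \<in> verts G"
    and hom: "\<phi> \<in> Q \<Longrightarrow> {i, j} \<in> F \<Longrightarrow> {\<phi> i, \<phi> j} \<in> edges G"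
    and colored: "\<phi> \<in> Q \<Longrightarrow> \<psi> \<in> Q \<Longrightarrow> i < k \<Longrightarrow> j < k \<Longrightarrow> \<phi> i = \<psi> j \<Longrightarrow> i = j"
    and edge_disjoint: "\<phi> \<in> Q \<Longrightarrow> \<psi> \<in> Q \<Longrightarrow> {i, j} \<in> F \<Longrightarrow> \<phi> i = \<psi> i \<Longrightarrow> \<phi> j = \<psi> j \<Longrightarrow> \<phi> = \<psi>"
    and deg_mono: "\<phi> \<in> Q \<Longrightarrow> i \<le> j \<Longrightarrow> j < k \<Longrightarrow> deg G (\<phi> i) \<le> deg G (\<phi> j)"
begin

lemma packing_subset:
  assumes "Q' \<subseteq> Q"
  shows "packing G k F Q'"
proof (unfold_locales, fact simple, fact pattern, fact pattern, fact pattern)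
  show "finite Q'" using finite_Q assms by (rule finite_subset[rotated])
  fix \<phi> i j assume \<phi>: "\<phi> \<in> Q'"
  then have "\<phi> \<in> Q" using assms by blast
  then show "i < k \<Longrightarrow> \<phi> i \<in> verts G" "{i, j} \<in> F \<Longrightarrow> {\<phi> i, \<phi> j} \<in> edges G"
    "i \<le> j \<Longrightarrow> j < k \<Longrightarrow> deg G (\<phi> i) \<le> deg G (\<phi> j)"
    using maps hom deg_mono by blast+
  fix \<psi> assume "\<psi> \<in> Q'"
  then have "\<psi> \<in> Q" using assms by blast
  then show "i < k \<Longrightarrow> j < k \<Longrightarrow> \<phi> i = \<psi> j \<Longrightarrow> i = j"
    "{i, j} \<in> F \<Longrightarrow> \<phi> i = \<psi> i \<Longrightarrow> \<phi> j = \<psi> j \<Longrightarrow> \<phi> = \<psi>"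
    using colored[OF \<open>\<phi> \<in> Q\<close>] edge_disjoint[OF \<open>\<phi> \<in> Q\<close>] by simp_all
qed

lemma finite_verts: "finite (verts G)"
  using simple by (simp add: simple_graph_def)

lemma neighbors_subset: "neighbors G v \<subseteq> verts G"
  using simple_graph_edgeD[OF simple] by (auto simp: neighbors_def)

lemma finite_neighbors: "finite (neighbors G v)"
  using neighbors_subset finite_verts by (rule finite_subset)

lemma pattern_edgeD:
  assumes "{i, j} \<in> F"
  shows "i \<noteq> j" "i < k" "j < k"
  using simple_graph_edgeD[OF pattern(1), of i j] assms by auto

lemma pattern_neighbor:
  assumes "i < k"
  shows "\<exists>j<k. {i, j} \<in> F"
proof -
  obtain i' where i': "i' < k" "i' \<noteq> i"
    using pattern(3) by (metis One_nat_def Suc_1 Suc_le_lessD less_trans not_less_eq zero_less_one zero_neq_one)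
  then have "(i, i') \<in> {(a, b). {a, b} \<in> F \<and> a \<in> {..<k} \<and> b \<in> {..<k}}\<^sup>*"
    using pattern(2) assms by (simp add: connected_in_def)
  then show ?thesis
    using i'(2) by (cases rule: converse_rtranclE) auto
qed

text \<open>Different copies through \<open>v\<close> leave it along different edges. So copies can
  be counted by neighbours of \<open>v\<close>, both to bound them by the degree and to bound from
  below the chance of a good answer.\<close>

lemma card_answers:
  assumes "{i, j} \<in> F"
  shows "card ((\<lambda>\<psi>. \<psi> j) ` {\<psi> \<in> Q. \<psi> i = v}) = card {\<psi> \<in> Q. \<psi> i = v}"
  using edge_disjoint[OF _ _ assms] by (intro card_image inj_onI) auto

lemma answers_subset:
  assumes "{i, j} \<in> F"
  shows "(\<lambda>\<psi>. \<psi> j) ` {\<psi> \<in> Q. \<psi> i = v} \<subseteq> neighbors G v"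
  using hom[OF _ assms] by (auto simp: neighbors_def)

lemma card_through_le_deg:
  assumes "i < k"
  shows "card {\<psi> \<in> Q. \<psi> i = v} \<le> deg G v"
proof -
  obtain j where ij: "{i, j} \<in> F" using pattern_neighbor[OF assms] by blast
  show ?thesis
    using card_mono[OF finite_neighbors answers_subset[OF ij, of v]] card_answers[OF ij, of v]
    unfolding deg_def by simp
qed

text \<open>Climb from \<open>x\<close> to \<open>i\<close> with \<open>branch_upper\<close>; every
  step starts at a colour below \<open>i\<close>, where coherence is assumed.\<close>

lemma branch_determined:
  assumes coh: "\<And>c j. c < i \<Longrightarrow> j \<in> upper F c \<Longrightarrow> coherent Q c j"
    and "x \<in> branch F i" "\<phi> \<in> Q" "\<psi> \<in> Q" "\<phi> x = \<psi> x"
  shows "\<phi> i = \<psi> i"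
  using assms(2,5)
proof (induction "i - x" arbitrary: x rule: less_induct)
  case less
  show ?case
  proof (cases "x = i")
    case False
    then obtain y where y: "y \<in> upper F x" "y \<in> branch F i"
      using branch_upper less.prems(1) by blast
    have "x < i" using False branch_le[OF less.prems(1)] by simp
    then have "\<phi> y = \<psi> y"
      using coh[OF _ y(1)] less.prems(2) assms(3,4) by (auto simp: coherent_def)
    moreover have "i - y < i - x" using y(1) \<open>x < i\<close> by (auto simp: upper_def)
    ultimately show ?thesis using less.hyps y(2) by blast
  qed (use less.prems in simp)
qed

text \<open>The images of \<open>branch F i\<close> under the copies through \<open>v\<close> are
  connected and share \<open>v\<close>.\<close>

lemma connected_in_branch_union:
  assumes "i < k"
  shows "connected_in (edges G) (\<Union>\<phi>\<in>{\<phi> \<in> Q. \<phi> i = v}. \<phi> ` branch F i)" (is "connected_in ?E ?X")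
proof -
  let ?R = "{(a, b). {a, b} \<in> ?E \<and> a \<in> ?X \<and> b \<in> ?X}"
  have star: "(v, y) \<in> ?R\<^sup>*" if "y \<in> ?X" for y
  proof -
    obtain \<phi> x where \<phi>: "\<phi> \<in> Q" "\<phi> i = v" "x \<in> branch F i" "y = \<phi> x" using \<open>y \<in> ?X\<close> by blast
    have "(i, x) \<in> {(a, b). {a, b} \<in> F \<and> a \<le> i \<and> b \<le> i}\<^sup>*" using \<phi>(3) by (simp add: branch_def)
    then have "(v, \<phi> x) \<in> ?R\<^sup>* \<and> x \<in> branch F i"
    proof induction
      case base
      then show ?case using \<phi>(2) by (simp add: branch_refl)
    next
      case (step a b)
      then have ab: "{a, b} \<in> F" "a \<in> branch F i" "b \<in> branch F i"
        using branch_step[of a F i b] by auto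
      have "\<phi> c \<in> ?X" if "c \<in> branch F i" for c using that \<phi>(1,2) by blast
      then have "(\<phi> a, \<phi> b) \<in> ?R" using ab hom[OF \<phi>(1) ab(1)] by simp
      then show ?case using step.IH ab(3) by (meson rtrancl.rtrancl_into_rtrancl)
    qed
    then show ?thesis using \<phi>(4) by simp
  qed
  show ?thesis
    unfolding connected_in_def using star rtrancl_edges_sym[of v _ ?E "\<lambda>a. a \<in> ?X"] by (meson rtrancl_trans)
qed

text \<open>Coherence below \<open>i\<close> makes the unions of the images of \<open>branch F i\<close> over the copies through
  different vertices of colour \<open>i\<close> disjoint. Contracting them turns the pairs of vertices of
  colours \<open>i\<close> and \<open>j\<close> into edges of a minor.\<close>

lemma card_pairs_le:
  assumes sparse: "sparse_minors C G"
    and i: "i < k" and j: "j \<in> upper F i"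
    and coh: "\<And>c j. c < i \<Longrightarrow> j \<in> upper F c \<Longrightarrow> coherent Q c j"
  shows "card {p \<in> (\<lambda>\<phi>. (\<phi> i, \<phi> j)) ` Q. s \<le> deg G (fst p)} \<le> C * card {v \<in> verts G. s \<le> deg G v}"
proof -
  define B where "B v = (\<Union>\<phi>\<in>{\<phi> \<in> Q. \<phi> i = v}. \<phi> ` branch F i)" for v
  define P where "P = {p \<in> (\<lambda>\<phi>. (\<phi> i, \<phi> j)) ` Q. s \<le> deg G (fst p)}"
  define Vi where "Vi = {v \<in> (\<lambda>\<phi>. \<phi> i) ` Q. s \<le> deg G v}"
  define Vj where "Vj = {v \<in> (\<lambda>\<phi>. \<phi> j) ` Q. s \<le> deg G v}"
  define \<B> where "\<B> = B ` Vi \<union> (\<lambda>w. {w}) ` Vj"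
  obtain x0 where x0: "x0 \<in> branch F i" "{x0, j} \<in> F" and ij: "i < j"
    using j by (auto simp: upper_def)
  have jk: "j < k" using pattern_edgeD[OF x0(2)] by simp
  have vB: "v \<in> B v" if "v \<in> Vi" for v
    using that branch_refl[of i F] unfolding B_def Vi_def by blast
  have branch_k: "x < k" if "x \<in> branch F i" for x using branch_le[OF that] i by simp
  \<comment> \<open>A common vertex has the same colour in both copies, and climbing from it leads
    to the same vertex of colour \<open>i\<close>.\<close>
  have same: "v = v'" if "z \<in> B v" "z \<in> B v'" for z v v'
  proof -
    obtain \<phi> x \<psi> y where *: "\<phi> \<in> Q" "\<phi> i = v" "x \<in> branch F i" "z = \<phi> x"
      "\<psi> \<in> Q" "\<psi> i = v'" "y \<in> branch F i" "z = \<psi> y"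
      using \<open>z \<in> B v\<close> \<open>z \<in> B v'\<close> unfolding B_def by blast
    then have "x = y" using colored[OF *(1,5), of x y] branch_k by auto
    then show ?thesis using branch_determined[OF coh *(3,1,5)] * by auto
  qed
  have BVj: "w \<notin> B v" if w: "w \<in> Vj" for v w
  proof
    assume "w \<in> B v"
    then obtain \<phi> x \<psi> where *: "\<phi> \<in> Q" "x \<in> branch F i" "w = \<phi> x" "\<psi> \<in> Q" "w = \<psi> j"
      using w unfolding B_def Vj_def by blast
    then have "x = j" using colored[OF *(1,4), of x j] branch_k jk by auto
    then show False using branch_le[OF *(2)] ij by simp
  qed
  have fin: "finite Vi" "finite Vj" using finite_Q by (auto simp: Vi_def Vj_def)
  have "connected_in (edges G) {w}" for w by (simp add: connected_in_def)
  moreover have "B v \<subseteq> verts G" for v using maps branch_k unfolding B_def by blast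
  moreover have "Vj \<subseteq> verts G" using maps jk by (auto simp: Vj_def)
  moreover have "connected_in (edges G) (B v)" for v
    unfolding B_def using connected_in_branch_union[OF i] .
  moreover have "disjoint \<B>"
  proof (rule pairwiseI)
    fix X Y assume XY: "X \<in> \<B>" "Y \<in> \<B>" "X \<noteq> Y"
    show "disjnt X Y"
    proof (rule ccontr)
      assume "\<not> disjnt X Y"
      then obtain z where z: "z \<in> X" "z \<in> Y" by (auto simp: disjnt_def)
      from XY(1) consider v where "v \<in> Vi" "X = B v" | "z \<in> Vj" "X = {z}"
        using z(1) unfolding \<B>_def by blast
      then show False
      proof cases
        case 1
        from XY(2) consider v where "v \<in> Vi" "Y = B v" | "z \<in> Vj"
          using z(2) unfolding \<B>_def by blast
        then show False using 1 XY(3) same z BVj by cases auto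
      next
        case 2
        from XY(2) consider v where "v \<in> Vi" "Y = B v" | "Y = {z}"
          using z(2) unfolding \<B>_def by blast
        then show False using 2 XY(3) z BVj by cases auto
      qed
    qed
  qed
  ultimately have "branch_family G \<B>"
    unfolding branch_family_def using fin vB by (auto simp: \<B>_def) blast
  then have 1: "card (links (edges G) \<B>) \<le> C * card \<B>"
    using sparse by (simp add: sparse_minors_def)
  have "card P \<le> card (links (edges G) \<B>)"
  proof (rule card_inj_on_le[where f = "\<lambda>(v, w). (B v, {w})"])
    have Vi_P: "v \<in> Vi" "w \<in> Vj" if vw: "(v, w) \<in> P" for v w
    proof -
      obtain \<phi> where \<phi>: "\<phi> \<in> Q" "v = \<phi> i" "w = \<phi> j" "s \<le> deg G v"
        using vw by (auto simp: P_def)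
      \<comment> \<open>Degrees grow with the colours, so a threshold met at colour \<open>i\<close>
        is met at colour \<open>j\<close>. The minor thus needs no more vertices than there are
        vertices of degree at least \<open>s\<close> in \<open>G\<close>.\<close>
      then have "s \<le> deg G w" using deg_mono[OF \<phi>(1), of i j] ij jk by simp
      then show "v \<in> Vi" "w \<in> Vj" using \<phi> unfolding Vi_def Vj_def by blast+
    qed
    show "inj_on (\<lambda>(v, w). (B v, {w})) P"
    proof (rule inj_onI)
      fix p p' assume p: "p \<in> P" "p' \<in> P"
        and eq: "(\<lambda>(v, w). (B v, {w})) p = (\<lambda>(v, w). (B v, {w})) p'"
      obtain v w v' w' where pp: "p = (v, w)" "p' = (v', w')" by (metis surj_pair)
      have "B v = B v'" "w = w'" using eq pp by simp_all
      moreover have "v \<in> B v" using vB Vi_P(1) p pp by blast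
      ultimately show "p = p'" using same[of v v v'] pp by simp
    qed
    show "(\<lambda>(v, w). (B v, {w})) ` P \<subseteq> links (edges G) \<B>"
    proof (rule image_subsetI)
      fix p assume "p \<in> P"
      then obtain v w \<phi> where p: "p = (v, w)" "(v, w) \<in> P" and \<phi>: "\<phi> \<in> Q" "v = \<phi> i" "w = \<phi> j"
        by (auto simp: P_def)
      have "\<phi> x0 \<in> B v"
        unfolding B_def using \<phi> x0(1) by (intro UN_I[of \<phi>] imageI) simp_all
      then have "touching (edges G) (B v) {w}"
        using hom[OF \<phi>(1) x0(2)] \<phi>(3) unfolding touching_def by blast
      moreover have "B v \<noteq> {w}" using BVj[of w v] Vi_P(2)[OF p(2)] by auto
      ultimately show "(\<lambda>(v, w). (B v, {w})) p \<in> links (edges G) \<B>"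
        using Vi_P[OF p(2)] p(1) by (simp add: links_def \<B>_def)
    qed
    show "finite (links (edges G) \<B>)" using fin by (simp add: finite_links \<B>_def)
  qed
  moreover have "card \<B> \<le> card {v \<in> verts G. s \<le> deg G v}"
  proof -
    have "card \<B> \<le> card Vi + card Vj"
      unfolding \<B>_def using fin by (meson add_mono card_Un_le card_image_le order_trans)
    also have "\<dots> = card (Vi \<union> Vj)"
    proof -
      have "Vi \<inter> Vj = {}" using BVj vB by blast
      then show ?thesis using fin by (simp add: card_Un_disjoint)
    qed
    also have "\<dots> \<le> card {v \<in> verts G. s \<le> deg G v}"
      using maps i jk finite_verts by (intro card_mono) (auto simp: Vi_def Vj_def)
    finally show ?thesis .
  qed
  ultimately show ?thesis
    using 1 unfolding P_def by (meson mult_le_mono2 order_trans)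
qed

end

section \<open>Counting copies against degrees\<close>

text \<open>The layer-cake formula, by exchanging the sums over elements and over
  thresholds.\<close>

lemma sum_eq_sum_card_ge:
  fixes f :: "'b \<Rightarrow> nat"
  assumes "finite A" "\<And>x. x \<in> A \<Longrightarrow> f x \<le> D"
  shows "(\<Sum>x\<in>A. f x) = (\<Sum>s=1..D. card {x \<in> A. s \<le> f x})"
proof -
  have "f x = (\<Sum>s=1..D. if s \<le> f x then 1 else 0)" if "x \<in> A" for x
  proof -
    have "{s \<in> {1..D}. s \<le> f x} = {1..f x}" using assms(2)[OF that] by auto
    then show ?thesis by (simp flip: sum.inter_filter)
  qed
  then have "(\<Sum>x\<in>A. f x) = (\<Sum>x\<in>A. \<Sum>s=1..D. if s \<le> f x then 1 else 0)" by simp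
  also have "\<dots> = (\<Sum>s=1..D. \<Sum>x\<in>A. if s \<le> f x then 1 else 0)" by (rule sum.swap)
  also have "\<dots> = (\<Sum>s=1..D. card {x \<in> A. s \<le> f x})"
    using assms(1) by (simp flip: sum.inter_filter)
  finally show ?thesis .
qed

lemma card_eq_sum_fibres: "finite A \<Longrightarrow> card A = (\<Sum>y\<in>f ` A. card {x \<in> A. f x = y})"
  using sum.image_gen[of A "\<lambda>_. 1::nat" f] by simp

lemma finite_has_maximiser:
  fixes f :: "'b \<Rightarrow> 'c::linorder"
  assumes "finite A" "A \<noteq> {}"
  shows "\<exists>a\<in>A. \<forall>x\<in>A. f x \<le> f a"
proof -
  have "Max (f ` A) \<in> f ` A" using assms by (intro Max_in) auto
  then obtain a where "a \<in> A" "Max (f ` A) = f a" by blast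
  then show ?thesis using assms(1) by (metis Max_ge finite_imageI imageI)
qed

context packing
begin

lemma deg_le: "deg G v \<le> card (verts G)"
  unfolding deg_def using neighbors_subset finite_verts by (rule card_mono[rotated])

lemma branch_family_singletons:
  assumes "U \<subseteq> verts G"
  shows "branch_family G ((\<lambda>v. {v}) ` U)"
  using assms finite_subset[OF assms finite_verts]
  by (auto simp: branch_family_def connected_in_def pairwise_def)

text \<open>Singletons are branch sets, so sparsity of minors covers induced subgraphs.\<close>

lemma card_arcs_le:
  assumes sparse: "sparse_minors C G" and U: "U \<subseteq> verts G"
  shows "card {(v, w). v \<in> U \<and> w \<in> U \<and> {v, w} \<in> edges G} \<le> C * card U"
proof -
  let ?\<B> = "(\<lambda>v. {v}) ` U"
  have fin: "finite U" using U finite_verts by (rule finite_subset)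
  have "card {(v, w). v \<in> U \<and> w \<in> U \<and> {v, w} \<in> edges G} \<le> card (links (edges G) ?\<B>)"
  proof (rule card_inj_on_le[where f = "\<lambda>(v, w). ({v}, {w})"])
    show "inj_on (\<lambda>(v, w). ({v}, {w})) {(v, w). v \<in> U \<and> w \<in> U \<and> {v, w} \<in> edges G}"
      by (rule inj_onI) (simp split: prod.splits)
    show "finite (links (edges G) ?\<B>)" using fin by (simp add: finite_links)
    show "(\<lambda>(v, w). ({v}, {w})) ` {(v, w). v \<in> U \<and> w \<in> U \<and> {v, w} \<in> edges G} \<subseteq> links (edges G) ?\<B>"
      using simple_graph_edgeD(1)[OF simple] by (auto simp: links_def touching_def)
  qed
  also have "\<dots> \<le> C * card ?\<B>"
    using sparse branch_family_singletons[OF U] by (simp add: sparse_minors_def)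
  also have "card ?\<B> = card U" by (simp add: card_image)
  finally show ?thesis .
qed

lemma sum_deg_le:
  assumes "sparse_minors C G"
  shows "(\<Sum>v\<in>verts G. deg G v) \<le> C * card (verts G)"
proof -
  have "(\<Sum>v\<in>verts G. deg G v) = card (SIGMA v:verts G. neighbors G v)"
    using finite_verts finite_neighbors by (simp add: deg_def)
  also have "(SIGMA v:verts G. neighbors G v) = {(v, w). v \<in> verts G \<and> w \<in> verts G \<and> {v, w} \<in> edges G}"
    using simple_graph_edgeD[OF simple] by (auto simp: neighbors_def)
  also have "card \<dots> \<le> C * card (verts G)" using card_arcs_le[OF assms order_refl] .
  finally show ?thesis .
qed

definition used :: "'a set" where
  "used = {\<phi> i |\<phi> i. \<phi> \<in> Q \<and> i < k}"

lemma used_subset: "used \<subseteq> verts G"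
  using maps by (auto simp: used_def)

text \<open>Every copy owns its edge between the colours \<open>0\<close> and \<open>j\<close>, and
  the edges among used vertices are few. Many copies therefore force many used vertices, which are
  the good start vertices.\<close>

lemma card_le_used:
  assumes "sparse_minors C G"
  shows "card Q \<le> C * card used"
proof -
  obtain j where j: "{0, j} \<in> F" using pattern_neighbor[of 0] pattern(3) by auto
  note jk = pattern_edgeD[OF j]
  have "card Q \<le> card {(v, w). v \<in> used \<and> w \<in> used \<and> {v, w} \<in> edges G}"
  proof (rule card_inj_on_le[where f = "\<lambda>\<phi>. (\<phi> 0, \<phi> j)"])
    show "inj_on (\<lambda>\<phi>. (\<phi> 0, \<phi> j)) Q" using edge_disjoint[OF _ _ j] by (intro inj_onI) simp
    show "(\<lambda>\<phi>. (\<phi> 0, \<phi> j)) ` Q \<subseteq> {(v, w). v \<in> used \<and> w \<in> used \<and> {v, w} \<in> edges G}"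
      using hom[OF _ j] jk unfolding used_def by blast
    have "finite used" using used_subset finite_verts by (rule finite_subset)
    then show "finite {(v, w). v \<in> used \<and> w \<in> used \<and> {v, w} \<in> edges G}"
      by - (rule finite_subset[of _ "used \<times> used"], auto)
  qed
  also have "\<dots> \<le> C * card used" using card_arcs_le[OF assms used_subset] .
  finally show ?thesis .
qed

text \<open>Sum \<open>card_pairs_le\<close> over all thresholds. One factor \<open>C\<close> comes
  from the minors, the other from the degree sum of \<open>G\<close>.\<close>

lemma sum_deg_pairs_le:
  assumes sparse: "sparse_minors C G"
    and i: "i < k" and j: "j \<in> upper F i"
    and coh: "\<And>c j. c < i \<Longrightarrow> j \<in> upper F c \<Longrightarrow> coherent Q c j"
  shows "(\<Sum>p\<in>(\<lambda>\<phi>. (\<phi> i, \<phi> j)) ` Q. deg G (fst p)) \<le> C * (C * card (verts G))"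
proof -
  let ?D = "card (verts G)" and ?P = "(\<lambda>\<phi>. (\<phi> i, \<phi> j)) ` Q"
  have "(\<Sum>p\<in>?P. deg G (fst p)) = (\<Sum>s=1..?D. card {p \<in> ?P. s \<le> deg G (fst p)})"
    using finite_Q deg_le by (intro sum_eq_sum_card_ge) auto
  also have "\<dots> \<le> (\<Sum>s=1..?D. C * card {v \<in> verts G. s \<le> deg G v})"
    using card_pairs_le[OF sparse i j coh] by (intro sum_mono) simp
  also have "\<dots> = C * (\<Sum>s=1..?D. card {v \<in> verts G. s \<le> deg G v})"
    by (simp add: sum_distrib_left)
  also have "(\<Sum>s=1..?D. card {v \<in> verts G. s \<le> deg G v}) = (\<Sum>v\<in>verts G. deg G v)"
    using finite_verts deg_le by (intro sum_eq_sum_card_ge[symmetric]) auto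
  also have "C * \<dots> \<le> C * (C * card (verts G))"
    using sum_deg_le[OF sparse] by simp
  finally show ?thesis .
qed

text \<open>Every vertex of colour \<open>i\<close> keeps only the copies through its most frequent partner of
  colour \<open>j\<close>; that this retains enough copies is the Cauchy--Schwarz inequality.\<close>

lemma coherent_step:
  assumes sparse: "sparse_minors C G"
    and i: "i < k" and j: "j \<in> upper F i"
    and coh: "\<And>c j. c < i \<Longrightarrow> j \<in> upper F c \<Longrightarrow> coherent Q c j"
  shows "\<exists>Q'\<subseteq>Q. coherent Q' i j \<and> card Q ^ 2 \<le> C ^ 2 * card (verts G) * card Q'"
proof -
  define V where "V = (\<lambda>\<phi>. \<phi> i) ` Q"
  define W where "W v = (\<lambda>\<phi>. \<phi> j) ` {\<phi> \<in> Q. \<phi> i = v}" for v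
  define q where "q v w = card {\<phi> \<in> Q. \<phi> i = v \<and> \<phi> j = w}" for v w
  define P where "P = (\<lambda>\<phi>. (\<phi> i, \<phi> j)) ` Q"
  have fin: "finite V" "finite (W v)" "finite P" for v using finite_Q by (auto simp: V_def W_def P_def)
  have P: "P = Sigma V W"
  proof (intro equalityI subrelI)
    fix v w assume "(v, w) \<in> P"
    then obtain \<phi> where "\<phi> \<in> Q" "v = \<phi> i" "w = \<phi> j" by (auto simp: P_def)
    then show "(v, w) \<in> Sigma V W" by (simp add: V_def W_def)
  next
    fix v w assume "(v, w) \<in> Sigma V W"
    then obtain \<phi> where "\<phi> \<in> Q" "\<phi> i = v" "w = \<phi> j" by (auto simp: W_def)
    then have "(v, w) = (\<phi> i, \<phi> j)" "\<phi> \<in> Q" by simp_all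
    then show "(v, w) \<in> P" unfolding P_def by (rule image_eqI)
  qed
  have "\<exists>w\<in>W v. \<forall>w'\<in>W v. q v w' \<le> q v w" if "v \<in> V" for v
    using that fin(2) by (intro finite_has_maximiser) (auto simp: V_def W_def)
  then obtain g where g: "\<And>v. v \<in> V \<Longrightarrow> g v \<in> W v"
    "\<And>v w. v \<in> V \<Longrightarrow> w \<in> W v \<Longrightarrow> q v w \<le> q v (g v)" by metis
  define Q' where "Q' = {\<phi> \<in> Q. \<phi> j = g (\<phi> i)}"
  have "{\<phi> \<in> Q. (\<phi> i, \<phi> j) = p} = {\<phi> \<in> Q. \<phi> i = fst p \<and> \<phi> j = snd p}" for p
    by (cases p) simp
  then have cQ: "card Q = (\<Sum>p\<in>P. q (fst p) (snd p))"
    unfolding P_def q_def using card_eq_sum_fibres[OF finite_Q, of "\<lambda>\<phi>. (\<phi> i, \<phi> j)"] by simp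
  have cV: "(\<Sum>w\<in>W v. q v w) = card {\<phi> \<in> Q. \<phi> i = v}" for v
    unfolding W_def q_def using card_eq_sum_fibres[of "{\<phi> \<in> Q. \<phi> i = v}" "\<lambda>\<phi>. \<phi> j"] finite_Q
    by (simp add: conj_assoc)
  have cQ': "card Q' = (\<Sum>v\<in>V. q v (g v))"
  proof -
    have "(\<lambda>\<phi>. \<phi> i) ` Q' = V"
    proof
      show "V \<subseteq> (\<lambda>\<phi>. \<phi> i) ` Q'"
      proof
        fix v assume "v \<in> V"
        from g(1)[OF this] obtain \<phi> where "\<phi> \<in> Q" "\<phi> i = v" "\<phi> j = g v" by (auto simp: W_def)
        then show "v \<in> (\<lambda>\<phi>. \<phi> i) ` Q'" by (auto simp: Q'_def)
      qed
    qed (auto simp: Q'_def V_def)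
    moreover have "{\<phi> \<in> Q'. \<phi> i = v} = {\<phi> \<in> Q. \<phi> i = v \<and> \<phi> j = g v}" for v
      by (auto simp: Q'_def)
    ultimately show ?thesis
      using card_eq_sum_fibres[of Q' "\<lambda>\<phi>. \<phi> i"] finite_Q by (simp add: q_def Q'_def)
  qed
  have pos: "0 < deg G v" if "v \<in> V" for v
  proof -
    have "{\<psi> \<in> Q. \<psi> i = v} \<noteq> {}" using that by (auto simp: V_def)
    then have "0 < card {\<psi> \<in> Q. \<psi> i = v}" using finite_Q by (simp add: card_gt_0_iff)
    then show ?thesis using card_through_le_deg[OF i, of v] by linarith
  qed
  \<comment> \<open>The split for Cauchy--Schwarz: \<open>q\<close> is the product of
    \<open>a\<close> and \<open>b\<close>, the squares of \<open>b\<close> are summed by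
    \<open>sum_deg_pairs_le\<close>, and those of \<open>a\<close> are bounded by the number of
    retained copies.\<close>
  define a where "a p = real (q (fst p) (snd p)) / sqrt (deg G (fst p))" for p
  define b where "b p = sqrt (deg G (fst p))" for p :: "'a \<times> 'a"
  have ab: "a p * b p = q (fst p) (snd p)" "(a p)\<^sup>2 = real (q (fst p) (snd p) ^ 2) / deg G (fst p)"
    "(b p)\<^sup>2 = deg G (fst p)" if "p \<in> P" for p
    using that pos[of "fst p"] by (auto simp: a_def b_def P power_divide)
  have "real (card Q) ^ 2 = (\<Sum>p\<in>P. a p * b p)\<^sup>2"
    using ab(1) cQ by simp
  also have "\<dots> \<le> (\<Sum>p\<in>P. (a p)\<^sup>2) * (\<Sum>p\<in>P. (b p)\<^sup>2)"
    by (rule Cauchy_Schwarz_ineq_sum)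
  also have "\<dots> \<le> real (card Q') * real (C * (C * card (verts G)))"
  proof (rule mult_mono)
    have "(\<Sum>p\<in>P. (b p)\<^sup>2) = real (\<Sum>p\<in>P. deg G (fst p))" using ab(3) by simp
    also have "\<dots> \<le> real (C * (C * card (verts G)))"
      unfolding of_nat_le_iff P_def using sum_deg_pairs_le[OF sparse i j coh] by blast
    finally show "(\<Sum>p\<in>P. (b p)\<^sup>2) \<le> real (C * (C * card (verts G)))" .
    have "(\<Sum>p\<in>P. (a p)\<^sup>2) = (\<Sum>p\<in>P. real (q (fst p) (snd p) ^ 2) / deg G (fst p))" using ab(2) by simp
    also have "\<dots> = (\<Sum>v\<in>V. \<Sum>w\<in>W v. real (q v w ^ 2) / deg G v)"
      unfolding P using fin by (subst sum.Sigma) (auto simp: case_prod_beta)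
    also have "\<dots> \<le> (\<Sum>v\<in>V. real (q v (g v)))"
    proof (rule sum_mono)
      fix v assume v: "v \<in> V"
      \<comment> \<open>One factor \<open>q v w\<close> is replaced by its maximum
        \<open>q v (g v)\<close>; the other factors add up to the copies through \<open>v\<close>,
        at most \<open>deg G v\<close> in number, which cancels the denominator.\<close>
      have "(\<Sum>w\<in>W v. q v w ^ 2) \<le> (\<Sum>w\<in>W v. q v (g v) * q v w)"
        unfolding power2_eq_square using g(2)[OF v] by (intro sum_mono mult_le_mono1)
      also have "\<dots> = q v (g v) * card {\<phi> \<in> Q. \<phi> i = v}"
        unfolding cV[symmetric] by (simp add: sum_distrib_left)
      also have "\<dots> \<le> q v (g v) * deg G v" using card_through_le_deg[OF i] by simp
      finally have "real (\<Sum>w\<in>W v. q v w ^ 2) \<le> real (q v (g v) * deg G v)" by (simp only: of_nat_le_iff)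
      then have "real (\<Sum>w\<in>W v. q v w ^ 2) / deg G v \<le> real (q v (g v))"
        using pos[OF v] by (simp add: divide_le_eq)
      then show "(\<Sum>w\<in>W v. real (q v w ^ 2) / deg G v) \<le> real (q v (g v))"
        by (simp add: sum_divide_distrib)
    qed
    finally show "(\<Sum>p\<in>P. (a p)\<^sup>2) \<le> real (card Q')" using cQ' by simp
  qed (auto simp: sum_nonneg)
  also have "\<dots> = real (C ^ 2 * card (verts G) * card Q')" by (simp add: power2_eq_square)
  finally have "real (card Q ^ 2) \<le> real (C ^ 2 * card (verts G) * card Q')" by simp
  then have "card Q ^ 2 \<le> C ^ 2 * card (verts G) * card Q'" by (simp only: of_nat_le_iff)
  moreover have "Q' \<subseteq> Q" "coherent Q' i j" by (auto simp: Q'_def coherent_def)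
  ultimately show ?thesis by blast
qed

end

text \<open>One application of \<open>coherent_step\<close> reduces the number of copies per vertex from \<open>x\<close> to
  at least \<open>x\<^sup>2 / C\<^sup>2\<close>; the minimum with \<open>x\<close> covers the steps at which nothing is to be done.\<close>

definition shrink :: "nat \<Rightarrow> real \<Rightarrow> real" where
  "shrink C x = min x (x\<^sup>2 / real C ^ 2)"

lemma shrink_pos: "0 < C \<Longrightarrow> 0 < x \<Longrightarrow> 0 < (shrink C ^^ s) x"
  by (induction s) (auto simp: shrink_def)

context packing
begin

lemma upper_less: "j \<in> upper F i \<Longrightarrow> j < k"
  using pattern_edgeD by (auto simp: upper_def)

text \<open>The pairs are treated in lexicographic order, coded as \<open>i * k + j\<close>. When
  \<open>(i, j)\<close> is reached, all colours below \<open>i\<close> are coherent already, as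
  \<open>coherent_step\<close> demands, and coherence survives in subfamilies.\<close>

lemma coherent_steps:
  fixes \<eta> :: real
  assumes sparse: "sparse_minors C G" and C: "0 < C" and \<eta>: "0 < \<eta>"
    and card: "\<eta> * card (verts G) \<le> card Q" and ne: "verts G \<noteq> {}"
  shows "\<exists>Q'\<subseteq>Q. (\<forall>i<k. \<forall>j\<in>upper F i. i * k + j < s \<longrightarrow> coherent Q' i j) \<and>
    (shrink C ^^ s) \<eta> * card (verts G) \<le> card Q'"
proof (induction s)
  case 0
  then show ?case using card by (intro exI[of _ Q]) auto
next
  case (Suc s)
  let ?n = "real (card (verts G))"
  define x where "x = (shrink C ^^ s) \<eta>"
  have x: "0 < x" unfolding x_def using C \<eta> by (rule shrink_pos)
  have n: "0 < ?n" using ne finite_verts by (simp add: card_gt_0_iff)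
  obtain Q1 where Q1: "Q1 \<subseteq> Q" "x * ?n \<le> card Q1"
    and coh: "\<And>i j. i < k \<Longrightarrow> j \<in> upper F i \<Longrightarrow> i * k + j < s \<Longrightarrow> coherent Q1 i j"
    using Suc.IH unfolding x_def by blast
  interpret Q1: packing G k F Q1 using packing_subset[OF Q1(1)] .
  define i where "i = s div k"
  define j where "j = s mod k"
  have s: "s = i * k + j" by (simp add: i_def j_def)
  have ij: "i' = i \<and> j' = j" if "i' * k + j' = s" "j' < k" for i' j'
    using that by (auto simp: i_def j_def)
  show ?case
  proof (cases "i < k \<and> j \<in> upper F i")
    case True
    have "coherent Q1 c j'" if "c < i" "j' \<in> upper F c" for c j'
    proof (rule coh)
      have "c * k + j' < c * k + k" using upper_less[OF that(2)] by simp
      also have "\<dots> = Suc c * k" by simp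
      also have "\<dots> \<le> i * k" using that(1) by (intro mult_le_mono1) simp
      finally show "c * k + j' < s" using s by simp
    qed (use that True in auto)
    then obtain Q2 where Q2: "Q2 \<subseteq> Q1" "coherent Q2 i j"
      "card Q1 ^ 2 \<le> C ^ 2 * card (verts G) * card Q2"
      using Q1.coherent_step[OF sparse, of i j] True by blast
    have "(x * ?n)\<^sup>2 \<le> (real (card Q1))\<^sup>2" using Q1(2) x n by (intro power_mono) auto
    also have "\<dots> \<le> real (C ^ 2 * card (verts G) * card Q2)"
      using Q2(3) by (metis of_nat_le_iff of_nat_power)
    finally have "x\<^sup>2 * ?n \<le> (real C)\<^sup>2 * card Q2"
      using n by (simp add: power2_eq_square algebra_simps)
    then have "x\<^sup>2 / real C ^ 2 * ?n \<le> card Q2"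
      using C by (simp add: field_simps)
    moreover have "shrink C x * ?n \<le> x\<^sup>2 / real C ^ 2 * ?n"
      unfolding shrink_def using n by (intro mult_right_mono) auto
    ultimately have "(shrink C ^^ Suc s) \<eta> * ?n \<le> card Q2" by (simp add: x_def)
    moreover have "coherent Q2 i' j'" if "i' < k" "j' \<in> upper F i'" "i' * k + j' < Suc s" for i' j'
    proof (cases "i' * k + j' = s")
      case True
      then show ?thesis using ij upper_less[OF that(2)] Q2(2) by simp
    next
      case False
      then show ?thesis using coh that coherent_subset[OF _ Q2(1)] by simp
    qed
    ultimately show ?thesis using Q1(1) Q2(1) by (intro exI[of _ Q2]) auto
  next
    case False
    have "shrink C x * ?n \<le> x * ?n"
      unfolding shrink_def using n by (intro mult_right_mono) auto
    then have "(shrink C ^^ Suc s) \<eta> * ?n \<le> card Q1" using Q1(2) by (simp add: x_def)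
    moreover have "coherent Q1 i' j'" if "i' < k" "j' \<in> upper F i'" "i' * k + j' < Suc s" for i' j'
    proof (rule coh)
      have "i' * k + j' \<noteq> s" using ij[of i' j'] upper_less[OF that(2)] that False by auto
      then show "i' * k + j' < s" using that(3) by simp
    qed (use that in auto)
    ultimately show ?thesis using Q1(1) by (intro exI[of _ Q1]) auto
  qed
qed

text \<open>A subfamily maximising the number of copies minus \<open>\<delta>\<close> times the total degree of the vertices
  it uses cannot gain by giving up all copies through a vertex.\<close>

lemma prune_low_degree:
  fixes \<eta> :: real
  assumes sparse: "sparse_minors C G" and C: "0 < C" and \<eta>: "0 < \<eta>"
    and card: "\<eta> * card (verts G) \<le> card Q"
  shows "\<exists>Q'\<subseteq>Q. \<eta> / 2 * card (verts G) \<le> card Q' \<and>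
    (\<forall>\<phi>\<in>Q'. \<forall>i<k. \<eta> / (2 * C) * deg G (\<phi> i) \<le> card {\<psi> \<in> Q'. \<psi> i = \<phi> i})"
proof -
  \<comment> \<open>The total degree is at most \<open>C * card (verts G)\<close>, so with this
    weight the penalty for \<open>Q\<close> itself eats up at most half of the guaranteed
    copies.\<close>
  define \<delta> where "\<delta> = \<eta> / (2 * C)"
  define pot where "pot R = real (card R) - \<delta> * (\<Sum>v\<in>packing.used k R. deg G v)" for R
  have "finite (Pow Q)" "Pow Q \<noteq> {}" using finite_Q by auto
  then obtain Q' where Q': "Q' \<subseteq> Q" and max: "\<And>R. R \<subseteq> Q \<Longrightarrow> pot R \<le> pot Q'"
    using finite_has_maximiser[of "Pow Q" pot] by blast
  interpret Q': packing G k F Q' using packing_subset[OF Q'] .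
  have \<delta>: "0 < \<delta>" using C \<eta> by (simp add: \<delta>_def)
  have fin: "finite Q'.used" using Q'.used_subset finite_verts by (rule finite_subset)
  have "(\<Sum>v\<in>used. deg G v) \<le> (\<Sum>v\<in>verts G. deg G v)"
    using used_subset finite_verts by (intro sum_mono2) auto
  then have "real (\<Sum>v\<in>used. deg G v) \<le> real (C * card (verts G))"
    using sum_deg_le[OF sparse] by (simp only: of_nat_le_iff)
  then have "\<delta> * (\<Sum>v\<in>used. deg G v) \<le> \<delta> * real (C * card (verts G))"
    using \<delta> by (intro mult_left_mono) auto
  also have "\<dots> = \<eta> / 2 * card (verts G)" using C by (simp add: \<delta>_def)
  finally have "\<eta> / 2 * card (verts G) \<le> pot Q" using card by (simp add: pot_def)
  also have "pot Q \<le> pot Q'" using max by simp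
  also have "pot Q' \<le> card Q'" using \<delta> by (simp add: pot_def sum_nonneg)
  finally have "\<eta> / 2 * card (verts G) \<le> card Q'" .
  moreover have "\<delta> * deg G (\<phi> i) \<le> card {\<psi> \<in> Q'. \<psi> i = \<phi> i}" if \<phi>: "\<phi> \<in> Q'" "i < k" for \<phi> i
  proof -
    define R where "R = {\<psi> \<in> Q'. \<psi> i \<noteq> \<phi> i}"
    have RQ': "R \<subseteq> Q'" by (auto simp: R_def)
    interpret R: packing G k F R using Q'.packing_subset[OF RQ'] .
    have "\<phi> i \<in> Q'.used" using \<phi> by (auto simp: Q'.used_def)
    \<comment> \<open>By \<open>colored\<close> the vertex \<open>\<phi> i\<close> occurs in no
      other position, so giving up the copies through it at colour \<open>i\<close> frees it
      altogether.\<close>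
    moreover have "R.used \<subseteq> Q'.used - {\<phi> i}"
    proof
      fix v assume "v \<in> R.used"
      then obtain \<psi> j where \<psi>: "\<psi> \<in> R" "j < k" "v = \<psi> j" by (auto simp: R.used_def)
      then have "v \<noteq> \<phi> i" using Q'.colored[of \<phi> \<psi> i j] \<phi> by (auto simp: R_def)
      then show "v \<in> Q'.used - {\<phi> i}" using \<psi> by (auto simp: Q'.used_def R_def)
    qed
    ultimately have "(\<Sum>v\<in>R.used. deg G v) + deg G (\<phi> i) \<le> (\<Sum>v\<in>Q'.used. deg G v)"
      using fin sum_mono2[of "Q'.used - {\<phi> i}" R.used "deg G"]
      by (simp add: sum.remove[of Q'.used "\<phi> i"])
    then have "real (\<Sum>v\<in>R.used. deg G v) + real (deg G (\<phi> i)) \<le> real (\<Sum>v\<in>Q'.used. deg G v)"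
      by (simp only: of_nat_le_iff flip: of_nat_add)
    then have 1: "\<delta> * real (\<Sum>v\<in>R.used. deg G v) + \<delta> * deg G (\<phi> i) \<le> \<delta> * real (\<Sum>v\<in>Q'.used. deg G v)"
      using \<delta> by (simp only: flip: distrib_left) simp
    have "card Q' = card {\<psi> \<in> Q'. \<psi> i = \<phi> i} + card R"
      unfolding R_def using Q'.finite_Q by (subst card_Un_disjoint[symmetric]) (auto intro!: arg_cong[of _ _ card])
    moreover have "pot R \<le> pot Q'" using RQ' Q' by (intro max) blast
    ultimately show ?thesis using 1 unfolding pot_def by simp
  qed
  ultimately show ?thesis using Q' unfolding \<delta>_def by blast
qed

end

text \<open>One condition for each task: \<open>coh\<close> glues the answers, \<open>robust\<close>
  makes answers along copies likely, and \<open>card_used\<close> makes it likely that the start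
  vertex lies on a copy.\<close>

locale robust_packing = packing +
  fixes \<delta> :: real
  assumes coh: "i < k \<Longrightarrow> j \<in> upper F i \<Longrightarrow> coherent Q i j"
    and robust: "\<phi> \<in> Q \<Longrightarrow> i < k \<Longrightarrow> \<delta> * deg G (\<phi> i) \<le> card {\<psi> \<in> Q. \<psi> i = \<phi> i}"
    and card_used: "\<delta> * card (verts G) \<le> card used"

text \<open>All pairs of colours are treated after \<open>k * k\<close> steps. Pruning halves the
  number of copies; its degree condition and \<open>card_le_used\<close> then both lead to the
  quotient by \<open>2 * C\<close>, so one constant serves for both.\<close>

lemma (in packing) ex_robust_packing:
  fixes \<eta> :: real
  assumes sparse: "sparse_minors C G" and C: "0 < C" and \<eta>: "0 < \<eta>"
    and card: "\<eta> * card (verts G) \<le> card Q" and ne: "verts G \<noteq> {}"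
  shows "\<exists>Q'. robust_packing G k F Q' ((shrink C ^^ (k * k)) \<eta> / (2 * C))"
proof -
  define x where "x = (shrink C ^^ (k * k)) \<eta>"
  have x: "0 < x" unfolding x_def using C \<eta> by (rule shrink_pos)
  obtain Q1 where Q1: "Q1 \<subseteq> Q" "x * card (verts G) \<le> card Q1"
    and coh: "\<And>i j. i < k \<Longrightarrow> j \<in> upper F i \<Longrightarrow> i * k + j < k * k \<Longrightarrow> coherent Q1 i j"
    using coherent_steps[OF assms, of "k * k"] unfolding x_def by blast
  interpret Q1: packing G k F Q1 using packing_subset[OF Q1(1)] .
  obtain Q2 where Q2: "Q2 \<subseteq> Q1" "x / 2 * card (verts G) \<le> card Q2"
    and robust: "\<And>\<phi> i. \<phi> \<in> Q2 \<Longrightarrow> i < k \<Longrightarrow> x / (2 * C) * deg G (\<phi> i) \<le> card {\<psi> \<in> Q2. \<psi> i = \<phi> i}"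
    using Q1.prune_low_degree[OF sparse C x Q1(2)] by blast
  interpret Q2: packing G k F Q2 using Q1.packing_subset[OF Q2(1)] .
  have "x / 2 * card (verts G) \<le> real (C * card Q2.used)"
    using Q2(2) Q2.card_le_used[OF sparse] by (meson of_nat_le_iff order_trans)
  then have "x / (2 * C) * card (verts G) \<le> card Q2.used" using C by (simp add: field_simps)
  moreover have "coherent Q2 i j" if "i < k" "j \<in> upper F i" for i j
  proof -
    have "i * k + j < Suc i * k" using upper_less[OF that(2)] by simp
    also have "\<dots> \<le> k * k" using that(1) by (intro mult_le_mono1) simp
    finally show ?thesis using coh that coherent_subset[OF _ Q2(1)] by blast
  qed
  ultimately have "robust_packing G k F Q2 (x / (2 * C))"
    using robust by unfold_locales auto
  then show ?thesis unfolding x_def by blast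
qed

section \<open>Gluing answers to a copy\<close>

lemma connected_in_branch: "connected_in F (branch F i)"
proof -
  let ?R = "{(a, b). {a, b} \<in> F \<and> a \<in> branch F i \<and> b \<in> branch F i}"
  have star: "(i, x) \<in> ?R\<^sup>*" if "x \<in> branch F i" for x
  proof -
    have "(i, x) \<in> {(a, b). {a, b} \<in> F \<and> a \<le> i \<and> b \<le> i}\<^sup>*" using that by (simp add: branch_def)
    then have "(i, x) \<in> ?R\<^sup>* \<and> x \<in> branch F i"
    proof induction
      case base
      show ?case by (simp add: branch_refl)
    next
      case (step a b)
      then have "b \<in> branch F i" using branch_step[of a F i b] by auto
      then have "(a, b) \<in> ?R" using step by auto
      then show ?case using step.IH \<open>b \<in> branch F i\<close> by (meson rtrancl.rtrancl_into_rtrancl)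
    qed
    then show ?thesis by simp
  qed
  show ?thesis
    unfolding connected_in_def using star rtrancl_edges_sym[of i _ F "\<lambda>a. a \<in> branch F i"] by (meson rtrancl_trans)
qed

context packing
begin

text \<open>A tree of answers of depth \<open>m\<close> below \<open>u\<close>. The copy
  \<open>\<psi>\<close> may differ for every \<open>j\<close> and at every level; a vertex on no
  copy only has to be present in \<open>K\<close>.\<close>

primrec explored :: "'a ugraph \<Rightarrow> nat \<Rightarrow> 'a \<Rightarrow> bool" where
  "explored K 0 u \<longleftrightarrow> u \<in> verts K"
| "explored K (Suc m) u \<longleftrightarrow> u \<in> verts K \<and>
     (\<forall>\<phi>\<in>Q. \<forall>i j. \<phi> i = u \<longrightarrow> {i, j} \<in> F \<longrightarrow>
       (\<exists>\<psi>\<in>Q. \<psi> i = u \<and> {u, \<psi> j} \<in> edges K \<and> explored K m (\<psi> j)))"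

lemma explored_vert: "explored K m u \<Longrightarrow> u \<in> verts K"
  by (cases m) auto

lemma explored_SucD:
  assumes "explored K (Suc m) u" "\<phi> \<in> Q" "\<phi> i = u" "{i, j} \<in> F"
  shows "\<exists>\<psi>\<in>Q. \<psi> i = u \<and> {u, \<psi> j} \<in> edges K \<and> explored K m (\<psi> j)"
  using assms unfolding explored.simps(2) by blast

lemma explored_Suc: "explored K (Suc m) u \<Longrightarrow> explored K m u"
proof (induction m arbitrary: u)
  case (Suc m)
  have "\<exists>\<psi>\<in>Q. \<psi> i = u \<and> {u, \<psi> j} \<in> edges K \<and> explored K m (\<psi> j)"
    if ij: "\<phi> \<in> Q" "\<phi> i = u" "{i, j} \<in> F" for \<phi> i j
  proof -
    obtain \<psi> where "\<psi> \<in> Q" "\<psi> i = u" "{u, \<psi> j} \<in> edges K" "explored K (Suc m) (\<psi> j)"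
      using Suc.prems ij unfolding explored.simps(2)[of K "Suc m"] by blast
    then show ?thesis using Suc.IH by blast
  qed
  then show ?case using explored_vert[OF Suc.prems] by simp
qed simp

lemma explored_antimono: "explored K m u \<Longrightarrow> n \<le> m \<Longrightarrow> explored K n u"
proof (induction m)
  case (Suc m)
  then show ?case using explored_Suc[OF Suc.prems(1)] by (cases "n = Suc m") (simp, simp del: explored.simps)
qed simp

end

context robust_packing
begin

lemma branch_determined':
  "i < k \<Longrightarrow> x \<in> branch F i \<Longrightarrow> \<phi> \<in> Q \<Longrightarrow> \<psi> \<in> Q \<Longrightarrow> \<phi> x = \<psi> x \<Longrightarrow> \<phi> i = \<psi> i"
  by (rule branch_determined[of i x]) (auto intro: coh)

text \<open>Every step of the walk may change the copy, but the walk stays inside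
  \<open>branch F i\<close>, so \<open>branch_determined'\<close> keeps the vertex of colour
  \<open>i\<close> fixed.\<close>

lemma explored_relpow:
  assumes "(a, b) \<in> {(a, b). {a, b} \<in> F \<and> a \<in> branch F i \<and> b \<in> branch F i} ^^ n"
    and "i < k" "\<phi> \<in> Q" "explored K (n + m) (\<phi> a)"
  shows "\<exists>\<psi>\<in>Q. \<psi> i = \<phi> i \<and> explored K m (\<psi> b)"
  using assms(1,3,4)
proof (induction n arbitrary: a \<phi>)
  case 0
  then show ?case by auto
next
  case (Suc n)
  obtain c where c: "{a, c} \<in> F" "a \<in> branch F i"
    and cb: "(c, b) \<in> {(a, b). {a, b} \<in> F \<and> a \<in> branch F i \<and> b \<in> branch F i} ^^ n"
    using relpow_Suc_D2[OF Suc.prems(1)] by auto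
  obtain \<psi> where \<psi>: "\<psi> \<in> Q" "\<psi> a = \<phi> a" "explored K (n + m) (\<psi> c)"
  proof -
    have "explored K (Suc (n + m)) (\<phi> a)" using Suc.prems(3) by simp
    then show thesis using that Suc.prems(2) c(1) unfolding explored.simps(2) by blast
  qed
  obtain \<psi>' where "\<psi>' \<in> Q" "\<psi>' i = \<psi> i" "explored K m (\<psi>' b)"
    using Suc.IH[OF cb \<psi>(1,3)] by blast
  moreover have "\<psi> i = \<phi> i"
    using branch_determined'[OF assms(2) c(2) \<psi>(1) Suc.prems(2) \<psi>(2)] .
  ultimately show ?case by auto
qed

text \<open>Some walk is no longer than the size of the step relation, hence than
  \<open>k * k\<close>; this is the number of levels spent.\<close>

lemma explored_walk:
  assumes "a \<in> branch F i" "b \<in> branch F i" "i < k" "\<phi> \<in> Q" "explored K (k * k + m) (\<phi> a)"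
  shows "\<exists>\<psi>\<in>Q. \<psi> i = \<phi> i \<and> explored K m (\<psi> b)"
proof -
  let ?R = "{(a, b). {a, b} \<in> F \<and> a \<in> branch F i \<and> b \<in> branch F i}"
  have sub: "?R \<subseteq> {..<k} \<times> {..<k}" using pattern_edgeD by auto
  then have fin: "finite ?R" by (rule finite_subset) simp
  have "card ?R \<le> card ({..<k} \<times> {..<k})" using sub by (intro card_mono) auto
  then have "card ?R \<le> k * k" by (simp add: card_cartesian_product)
  moreover have "(a, b) \<in> ?R\<^sup>*"
    using connected_in_branch assms(1,2) unfolding connected_in_def by blast
  then obtain n where n: "n \<le> card ?R" "(a, b) \<in> ?R ^^ n"
    unfolding rtrancl_finite_eq_relpow[OF fin] by blast
  ultimately have "explored K (n + m) (\<phi> a)"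
    using explored_antimono[OF assms(5), of "n + m"] by simp
  then show ?thesis using explored_relpow[OF n(2) assms(3,4)] by blast
qed

text \<open>As the pattern is connected, the top colour is the root of the elimination tree.\<close>

lemma branch_top: "x < k \<Longrightarrow> x \<in> branch F (k - 1)"
proof -
  assume x: "x < k"
  have "{(a, b). {a, b} \<in> F \<and> a \<in> {..<k} \<and> b \<in> {..<k}} = {(a, b). {a, b} \<in> F \<and> a \<le> k - 1 \<and> b \<le> k - 1}"
    using pattern(3) by auto
  then show ?thesis
    using pattern(2,3) x unfolding connected_in_def branch_def by auto
qed

lemma upper_nonempty:
  assumes "c < k - 1"
  shows "upper F c \<noteq> {}"
  using branch_upper[OF branch_top[of c]] assms by force

text \<open>The copy is assembled from the highest colour downwards: if \<open>p\<close> is the least element of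
  \<open>upper F c\<close>, then walking inside \<open>branch F p\<close> from the vertex chosen for \<open>p\<close> to one of colour
  \<open>c\<close> cannot change the vertex of colour \<open>p\<close>, and by coherence not those of the colours in
  \<open>upper F p\<close> either.\<close>

lemma partial_copy:
  assumes u: "u \<in> used" "explored K (k * (k * k) + 1) u" and "d < k"
  shows "\<exists>\<theta>. \<forall>x. k - 1 - d \<le> x \<longrightarrow> x < k \<longrightarrow> explored K (x * (k * k) + 1) (\<theta> x) \<and>
    (\<exists>\<psi>\<in>Q. \<psi> x = \<theta> x \<and> (\<forall>y\<in>upper F x. \<psi> y = \<theta> y))"
  using \<open>d < k\<close>
proof (induction d)
  case 0
  obtain \<phi> i where \<phi>: "\<phi> \<in> Q" "i < k" "u = \<phi> i" using u(1) by (auto simp: used_def)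
  \<comment> \<open>The walk from the colour of \<open>u\<close> to the top colour spends the first
    \<open>k * k\<close> levels.\<close>
  have "k * (k * k) + 1 = k * k + ((k - 1) * (k * k) + 1)"
    using pattern(3) by (cases k) auto
  then have "explored K (k * k + ((k - 1) * (k * k) + 1)) (\<phi> i)" using u(2) \<phi>(3) by metis
  moreover have k: "k - 1 < k" using pattern(3) by simp
  ultimately obtain \<psi> where \<psi>: "\<psi> \<in> Q" "explored K ((k - 1) * (k * k) + 1) (\<psi> (k - 1))"
    using explored_walk[OF branch_top[OF \<phi>(2)] branch_refl k \<phi>(1)] by blast
  moreover have "upper F (k - 1) = {}" using upper_less[of _ "k - 1"] by (force simp: upper_def)
  moreover have "x = k - 1" if "k - 1 - 0 \<le> x" "x < k" for x using that by simp
  ultimately show ?case by (intro exI[of _ \<psi>]) (metis empty_iff)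
next
  case (Suc d)
  define c where "c = k - 1 - Suc d"
  have c: "Suc c = k - 1 - d" "c < k - 1" using Suc.prems by (auto simp: c_def)
  obtain \<theta> where \<theta>: "\<And>x. Suc c \<le> x \<Longrightarrow> x < k \<Longrightarrow> explored K (x * (k * k) + 1) (\<theta> x) \<and>
    (\<exists>\<psi>\<in>Q. \<psi> x = \<theta> x \<and> (\<forall>y\<in>upper F x. \<psi> y = \<theta> y))"
    using Suc.IH Suc.prems unfolding c(1) by auto
  define p where "p = (LEAST p. p \<in> upper F c)"
  have p: "p \<in> upper F c" unfolding p_def using upper_nonempty[OF c(2)] by (auto intro: LeastI)
  have pmin: "p \<le> y" if "y \<in> upper F c" for y unfolding p_def using that by (rule Least_le)
  obtain x where x: "x \<in> branch F c" "{x, p} \<in> F" and cp: "c < p" using p by (auto simp: upper_def)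
  have pk: "p < k" using upper_less[OF p] .
  have sym: "{p, x} \<in> F" using x(2) by (simp add: insert_commute)
  \<comment> \<open>The neighbour \<open>x\<close> of \<open>p\<close> is smaller than
    \<open>p\<close>, so it lies in \<open>branch F p\<close>; a path inside
    \<open>branch F c\<close>, all of it below \<open>p\<close>, takes \<open>c\<close> there as
    well.\<close>
  have xp: "x \<in> branch F p"
    using branch_step[OF branch_refl sym] branch_le[OF x(1)] cp by simp
  have "(x, c) \<in> {(a, b). {a, b} \<in> F \<and> a \<in> branch F c \<and> b \<in> branch F c}\<^sup>*"
    using connected_in_branch[of F c] x(1) branch_refl[of c F] unfolding connected_in_def by blast
  then have cb: "c \<in> branch F p"
  proof induction
    case (step a b)
    have "b \<le> p" using step(2) branch_le[of b F c] cp by auto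
    then show ?case using branch_step[OF step.IH] step(2) by auto
  qed (rule xp)
  note sub = branch_subset[OF cb]
  obtain \<psi>p where \<psi>p: "\<psi>p \<in> Q" "\<psi>p p = \<theta> p" "\<And>y. y \<in> upper F p \<Longrightarrow> \<psi>p y = \<theta> y"
    and ex: "explored K (p * (k * k) + 1) (\<psi>p p)"
    using \<theta>[of p] cp pk by auto
  \<comment> \<open>A descent costs \<open>k * k\<close> levels, and \<open>c < p\<close> leaves at
    least that many.\<close>
  have "k * k + (c * (k * k) + 1) = Suc c * (k * k) + 1" by simp
  also have "\<dots> \<le> p * (k * k) + 1" using cp by (intro add_right_mono mult_le_mono1) simp
  finally have "explored K (k * k + (c * (k * k) + 1)) (\<psi>p p)"
    by (rule explored_antimono[OF ex])
  then obtain \<psi> where \<psi>: "\<psi> \<in> Q" "\<psi> p = \<psi>p p" "explored K (c * (k * k) + 1) (\<psi> c)"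
    using explored_walk[OF branch_refl cb pk \<psi>p(1)] by blast
  have up: "\<psi> y = \<theta> y" if "y \<in> upper F c" for y
  proof (cases "y = p")
    case True
    then show ?thesis using \<psi>(2) \<psi>p(2) by simp
  next
    case False
    \<comment> \<open>The elimination order is perfect: as \<open>branch F c\<close> is contained in
      \<open>branch F p\<close>, the upper neighbours of \<open>c\<close> other than
      \<open>p\<close> are upper neighbours of \<open>p\<close>.\<close>
    then have "p < y" using pmin[OF that] by simp
    then have y: "y \<in> upper F p" using that sub unfolding upper_def by blast
    have "\<psi> y = \<psi>p y" using coh[OF pk y] \<psi>(1,2) \<psi>p(1) unfolding coherent_def by blast
    then show ?thesis using \<psi>p(3)[OF y] by simp
  qed
  have gt: "c < y" if "y \<in> upper F x" "c \<le> x" for x y using that by (auto simp: upper_def)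
  show ?case unfolding c_def[symmetric]
  proof (intro exI[of _ "\<theta>(c := \<psi> c)"] allI impI)
    fix x assume x: "c \<le> x" "x < k"
    show "explored K (x * (k * k) + 1) ((\<theta>(c := \<psi> c)) x) \<and>
      (\<exists>\<psi>'\<in>Q. \<psi>' x = (\<theta>(c := \<psi> c)) x \<and> (\<forall>y\<in>upper F x. \<psi>' y = (\<theta>(c := \<psi> c)) y))"
    proof (cases "x = c")
      case True
      have "\<psi> y = (\<theta>(c := \<psi> c)) y" if "y \<in> upper F c" for y
        using up[OF that] gt[OF that order_refl] by simp
      then show ?thesis unfolding True using \<psi>(1,3) by auto
    next
      case False
      then have "Suc c \<le> x" using x(1) by simp
      from \<theta>[OF this x(2)] obtain \<psi>' where "explored K (x * (k * k) + 1) (\<theta> x)"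
        "\<psi>' \<in> Q" "\<psi>' x = \<theta> x" "\<And>y. y \<in> upper F x \<Longrightarrow> \<psi>' y = \<theta> y" by blast
      moreover have "(\<theta>(c := \<psi> c)) y = \<theta> y" if "y \<in> upper F x" for y using gt[OF that x(1)] by simp
      ultimately show ?thesis using False by auto
    qed
  qed
qed

text \<open>For an edge \<open>{i, j}\<close> with \<open>i < j\<close>, the last level provides an
  edge from \<open>\<theta> i\<close> to some \<open>\<psi>' j\<close>, and coherence identifies
  \<open>\<psi>' j\<close> with \<open>\<theta> j\<close>. Injectivity comes from the
  colours.\<close>

lemma explored_copy:
  assumes u: "u \<in> used" "explored K (k * (k * k) + 1) u"
  shows "\<exists>\<theta>. inj_on \<theta> {..<k} \<and> \<theta> ` {..<k} \<subseteq> verts K \<and>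
    (\<forall>i j. {i, j} \<in> F \<longrightarrow> {\<theta> i, \<theta> j} \<in> edges K)"
proof -
  have "k - 1 < k" using pattern(3) by simp
  from partial_copy[OF u this] obtain \<theta> where
    \<theta>: "\<And>x. x < k \<Longrightarrow> explored K (x * (k * k) + 1) (\<theta> x) \<and>
      (\<exists>\<psi>\<in>Q. \<psi> x = \<theta> x \<and> (\<forall>y\<in>upper F x. \<psi> y = \<theta> y))" by auto
  have "inj_on \<theta> {..<k}"
  proof (rule inj_onI)
    fix i j assume ij: "i \<in> {..<k}" "j \<in> {..<k}" "\<theta> i = \<theta> j"
    obtain \<phi> \<psi> where "\<phi> \<in> Q" "\<phi> i = \<theta> i" "\<psi> \<in> Q" "\<psi> j = \<theta> j"
      using \<theta>[of i] \<theta>[of j] ij by auto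
    then show "i = j" using colored[of \<phi> \<psi> i j] ij by simp
  qed
  moreover have "\<theta> ` {..<k} \<subseteq> verts K" using \<theta> explored_vert by blast
  moreover have lt: "{\<theta> i, \<theta> j} \<in> edges K" if ij: "{i, j} \<in> F" "i < j" for i j
  proof -
    have k: "i < k" "j < k" using pattern_edgeD[OF ij(1)] by auto
    have j: "j \<in> upper F i" using ij branch_refl[of i F] by (auto simp: upper_def)
    obtain \<psi> where \<psi>: "\<psi> \<in> Q" "\<psi> i = \<theta> i" "\<psi> j = \<theta> j" using \<theta>[OF k(1)] j by blast
    have ex: "explored K (Suc 0) (\<theta> i)" using \<theta>[OF k(1)] explored_antimono[of K "i * (k * k) + 1" "\<theta> i" "Suc 0"] by simp
    obtain \<psi>' where \<psi>': "\<psi>' \<in> Q" "\<psi>' i = \<theta> i" "{\<theta> i, \<psi>' j} \<in> edges K"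
      using explored_SucD[OF ex \<psi>(1,2) ij(1)] by blast
    have "\<psi>' i = \<psi> i" using \<psi>(2) \<psi>'(2) by simp
    then have "\<psi>' j = \<psi> j" using coh[OF k(1) j] \<psi>(1) \<psi>'(1) unfolding coherent_def by blast
    then show ?thesis using \<psi>'(3) \<psi>(3) by simp
  qed
  moreover have "{\<theta> i, \<theta> j} \<in> edges K" if ij: "{i, j} \<in> F" for i j
  proof (cases "i < j")
    case True
    show ?thesis using lt[OF ij True] .
  next
    case False
    then have "j < i" using pattern_edgeD(1)[OF ij] by simp
    moreover have "{j, i} \<in> F" using ij by (simp add: insert_commute)
    ultimately have "{\<theta> j, \<theta> i} \<in> edges K" by (rule lt[rotated])
    then show ?thesis by (simp add: insert_commute)
  qed
  ultimately show ?thesis by blast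
qed

end

section \<open>Probability of complete answers\<close>

lemma prob_bind_pmf:
  "measure_pmf.prob (bind_pmf p f) E = (\<integral>x. measure_pmf.prob (f x) E \<partial>measure_pmf p)"
proof -
  \<comment> \<open>An event becomes a value of a Boolean distribution, to which
    \<open>pmf_bind\<close> applies.\<close>
  have prob: "measure_pmf.prob q E = pmf (map_pmf (\<lambda>y. y \<in> E) q) True" for q
    by (simp add: pmf_map vimage_def)
  show ?thesis unfolding prob by (simp add: map_bind_pmf pmf_bind)
qed

text \<open>A union bound over two stages. Where \<open>P\<close> fails, the integrated lower bound
  is \<open>- x\<close>, hence the assumption \<open>0 \<le> x\<close>.\<close>

lemma prob_bind_pmf_ge:
  assumes a: "measure_pmf.prob p {y. \<not> P y} \<le> a"
    and x: "\<And>y. y \<in> set_pmf p \<Longrightarrow> P y \<Longrightarrow> 1 - x \<le> measure_pmf.prob (f y) E" and "0 \<le> x"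
  shows "1 - a - x \<le> measure_pmf.prob (bind_pmf p f) E"
proof -
  have ind: "integrable (measure_pmf p) (\<lambda>y. indicator {y. \<not> P y} y :: real)"
    by (intro measure_pmf.integrable_const_bound[where B = 1]) (auto simp: indicator_def)
  then have int: "integrable (measure_pmf p) (\<lambda>y. 1 - x - indicator {y. \<not> P y} y :: real)"
    by simp
  have "1 - x - measure_pmf.prob p {y. \<not> P y} = (\<integral>y. 1 - x - indicator {y. \<not> P y} y \<partial>measure_pmf p)"
    using ind by (subst Bochner_Integration.integral_diff) auto
  also have "\<dots> \<le> (\<integral>y. measure_pmf.prob (f y) E \<partial>measure_pmf p)"
  proof (rule integral_mono_AE[OF int])
    show "integrable (measure_pmf p) (\<lambda>y. measure_pmf.prob (f y) E)"
      by (intro measure_pmf.integrable_const_bound[where B = 1]) auto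
    show "AE y in measure_pmf p. 1 - x - indicator {y. \<not> P y} y \<le> measure_pmf.prob (f y) E"
    proof (rule AE_pmfI)
      fix y assume "y \<in> set_pmf p"
      then show "1 - x - indicator {y. \<not> P y} y \<le> measure_pmf.prob (f y) E"
        using x[of y] \<open>0 \<le> x\<close> by (cases "P y") (auto intro: order_trans[of "- x" 0])
    qed
  qed
  finally show ?thesis using a by (simp add: prob_bind_pmf)
qed

lemma prob_replicate_pmf_avoid:
  "measure_pmf.prob (replicate_pmf d p) {xs. set xs \<inter> B = {}} = measure_pmf.prob p (- B) ^ d"
proof (induction d)
  case 0
  then show ?case by simp
next
  case (Suc d)
  have "measure_pmf.prob (replicate_pmf (Suc d) p) {xs. set xs \<inter> B = {}} =
      (\<integral>x. indicator (- B) x * measure_pmf.prob p (- B) ^ d \<partial>measure_pmf p)"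
    unfolding replicate_pmf.simps prob_bind_pmf
  proof (intro Bochner_Integration.integral_cong refl)
    fix x
    have "(\<integral>xs. measure_pmf.prob (return_pmf (x # xs)) {xs. set xs \<inter> B = {}} \<partial>measure_pmf (replicate_pmf d p)) =
        (\<integral>xs. indicator (- B) x * indicator {xs. set xs \<inter> B = {}} xs \<partial>measure_pmf (replicate_pmf d p))"
      by (intro Bochner_Integration.integral_cong refl) (auto simp: indicator_def)
    also have "\<dots> = indicator (- B) x * measure_pmf.prob p (- B) ^ d"
      using Suc.IH by simp
    finally show "(\<integral>xs. measure_pmf.prob (return_pmf (x # xs)) {xs. set xs \<inter> B = {}} \<partial>measure_pmf (replicate_pmf d p)) =
        indicator (- B) x * measure_pmf.prob p (- B) ^ d" .
  qed
  also have "\<dots> = measure_pmf.prob p (- B) ^ Suc d" by simp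
  finally show ?case .
qed

lemma set_query_answers:
  assumes "finite (neighbors G u)" "A \<in> set_pmf (query_answers G d u)"
  shows "A \<subseteq> neighbors G u" "finite A" "card A \<le> d"
proof -
  obtain xs where xs: "xs \<in> set_pmf (replicate_pmf d (random_neighbor G u))" "A = {x. Some x \<in> set xs}"
    using assms(2) by (auto simp: query_answers_def)
  then have len: "length xs = d" and "set xs \<subseteq> set_pmf (random_neighbor G u)"
    by (auto simp: set_replicate_pmf)
  moreover have "set_pmf (random_neighbor G u) \<subseteq> insert None (Some ` neighbors G u)"
    using assms(1) by (auto simp: random_neighbor_def set_pmf_of_set)
  ultimately show "A \<subseteq> neighbors G u" using xs(2) by auto
  have "A \<subseteq> the ` set xs" unfolding xs(2) by force
  then show "finite A" "card A \<le> d"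
    using len card_image_le[of "set xs" the] card_length[of xs] card_mono[of "the ` set xs" A]
    by (auto intro: finite_subset)
qed

text \<open>The queries are independent, and each one hits \<open>A\<close> with probability at
  least \<open>\<delta>\<close>.\<close>

lemma prob_query_answers_avoid:
  fixes \<delta> :: real
  assumes fin: "finite (neighbors G u)" and A: "A \<subseteq> neighbors G u" "A \<noteq> {}"
    and \<delta>: "\<delta> * card (neighbors G u) \<le> card A"
  shows "measure_pmf.prob (query_answers G d u) {\<Gamma>. \<Gamma> \<inter> A = {}} \<le> (1 - \<delta>) ^ d"
proof -
  have ne: "neighbors G u \<noteq> {}" using A by blast
  then have pos: "0 < card (neighbors G u)" using fin by (simp add: card_gt_0_iff)
  have "(\<lambda>xs. {x. Some x \<in> set xs}) -` {\<Gamma>. \<Gamma> \<inter> A = {}} = {xs. set xs \<inter> Some ` A = {}}" by auto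
  then have "measure_pmf.prob (query_answers G d u) {\<Gamma>. \<Gamma> \<inter> A = {}} =
      measure_pmf.prob (random_neighbor G u) (- (Some ` A)) ^ d"
    by (simp add: query_answers_def prob_replicate_pmf_avoid)
  also have "measure_pmf.prob (random_neighbor G u) (- (Some ` A)) =
      measure_pmf.prob (pmf_of_set (neighbors G u)) (- A)"
    using ne by (simp add: random_neighbor_def vimage_Compl inj_vimage_image_eq)
  also have "\<dots> = 1 - card A / card (neighbors G u)"
  proof -
    have "measure_pmf.prob (pmf_of_set (neighbors G u)) A = card A / card (neighbors G u)"
      using ne fin A by (simp add: measure_pmf_of_set Int_absorb1)
    then show ?thesis using measure_pmf.prob_compl[of A "pmf_of_set (neighbors G u)"] by (simp add: Compl_eq_Diff_UNIV)
  qed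
  also have "\<dots> ^ d \<le> (1 - \<delta>) ^ d"
  proof (rule power_mono)
    show "1 - real (card A) / real (card (neighbors G u)) \<le> 1 - \<delta>"
      using \<delta> pos by (simp add: field_simps)
    show "0 \<le> 1 - real (card A) / real (card (neighbors G u))"
      using card_mono[OF fin A(1)] pos by (simp add: field_simps)
  qed
  finally show ?thesis .
qed

context robust_packing
begin

definition answered :: "'a \<Rightarrow> 'a set \<Rightarrow> bool" where
  "answered u \<Gamma> \<longleftrightarrow> (\<forall>\<phi>\<in>Q. \<forall>i j. \<phi> i = u \<longrightarrow> {i, j} \<in> F \<longrightarrow> (\<exists>\<psi>\<in>Q. \<psi> i = u \<and> \<psi> j \<in> \<Gamma>))"

lemma delta_le_1:
  assumes "\<phi> \<in> Q"
  shows "\<delta> \<le> 1"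
proof -
  have k: "0 < k" using pattern(3) by simp
  have "\<phi> \<in> {\<psi> \<in> Q. \<psi> 0 = \<phi> 0}" using assms by simp
  then have "0 < card {\<psi> \<in> Q. \<psi> 0 = \<phi> 0}" using finite_Q by (auto simp: card_gt_0_iff)
  then have pos: "0 < deg G (\<phi> 0)" using card_through_le_deg[OF k, of "\<phi> 0"] by linarith
  have "\<delta> * deg G (\<phi> 0) \<le> deg G (\<phi> 0)"
    using robust[OF assms k] card_through_le_deg[OF k, of "\<phi> 0"] by linarith
  then show ?thesis using pos by simp
qed

text \<open>A vertex on no copy is answered vacuously. Otherwise its colour \<open>i\<close> is
  unique, and the union bound runs over the at most \<open>k\<close> neighbours \<open>j\<close> of
  \<open>i\<close>. The good answers for \<open>j\<close> are as many as the copies through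
  \<open>u\<close>, by robustness at least a fraction \<open>\<delta>\<close> of the degree.\<close>

lemma prob_not_answered:
  assumes "\<delta> \<le> 1"
  shows "measure_pmf.prob (query_answers G d u) {\<Gamma>. \<not> answered u \<Gamma>} \<le> k * (1 - \<delta>) ^ d"
proof (cases "\<exists>\<phi>\<in>Q. \<exists>i<k. \<phi> i = u")
  case False
  have "answered u \<Gamma>" for \<Gamma>
    using False pattern_edgeD(2) unfolding answered_def by blast
  then show ?thesis using assms by simp
next
  case True
  then obtain \<phi> i where \<phi>: "\<phi> \<in> Q" "i < k" "\<phi> i = u" by blast
  define A where "A j = (\<lambda>\<psi>. \<psi> j) ` {\<psi> \<in> Q. \<psi> i = u}" for j
  define J where "J = {j. {i, j} \<in> F}"
  have J: "J \<subseteq> {..<k}" using pattern_edgeD(3) by (auto simp: J_def)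
  then have finJ: "finite J" by (rule finite_subset) simp
  have "answered u \<Gamma>" if "\<forall>j\<in>J. \<Gamma> \<inter> A j \<noteq> {}" for \<Gamma>
    unfolding answered_def
  proof (intro ballI allI impI)
    fix \<psi> i' j assume *: "\<psi> \<in> Q" "\<psi> i' = u" "{i', j} \<in> F"
    then have "i' = i" using colored[of \<psi> \<phi> i' i] \<phi> pattern_edgeD(2) by auto
    then have "\<Gamma> \<inter> A j \<noteq> {}" using that *(3) by (simp add: J_def)
    then show "\<exists>\<psi>\<in>Q. \<psi> i' = u \<and> \<psi> j \<in> \<Gamma>" using \<open>i' = i\<close> by (auto simp: A_def)
  qed
  then have "{\<Gamma>. \<not> answered u \<Gamma>} \<subseteq> (\<Union>j\<in>J. {\<Gamma>. \<Gamma> \<inter> A j = {}})" by blast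
  then have "measure_pmf.prob (query_answers G d u) {\<Gamma>. \<not> answered u \<Gamma>} \<le>
      measure_pmf.prob (query_answers G d u) (\<Union>j\<in>J. {\<Gamma>. \<Gamma> \<inter> A j = {}})"
    by (intro measure_pmf.finite_measure_mono) auto
  also have "\<dots> \<le> (\<Sum>j\<in>J. measure_pmf.prob (query_answers G d u) {\<Gamma>. \<Gamma> \<inter> A j = {}})"
    using finJ by (intro measure_pmf.finite_measure_subadditive_finite) auto
  also have "\<dots> \<le> (\<Sum>j\<in>J. (1 - \<delta>) ^ d)"
  proof (rule sum_mono)
    fix j assume "j \<in> J"
    then have ij: "{i, j} \<in> F" by (simp add: J_def)
    show "measure_pmf.prob (query_answers G d u) {\<Gamma>. \<Gamma> \<inter> A j = {}} \<le> (1 - \<delta>) ^ d"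
    proof (rule prob_query_answers_avoid[OF finite_neighbors])
      show "A j \<subseteq> neighbors G u" unfolding A_def by (rule answers_subset[OF ij])
      show "A j \<noteq> {}" using \<phi> by (auto simp: A_def)
      show "\<delta> * card (neighbors G u) \<le> card (A j)"
        using robust[OF \<phi>(1,2)] \<phi>(3) card_answers[OF ij, of u] by (simp add: A_def deg_def)
    qed
  qed
  also have "\<dots> \<le> k * (1 - \<delta>) ^ d"
    using card_mono[OF _ J] assms by (simp add: mult_right_mono)
  finally show ?thesis .
qed

text \<open>The condition \<open>answered\<close>, read off from the visited vertices and recorded
  edges. It is monotone in both, which matters because the traversal queries a vertex at one level
  only.\<close>

definition settled :: "'a \<Rightarrow> 'a set \<Rightarrow> 'a set set \<Rightarrow> bool" where
  "settled u S R \<longleftrightarrow> (\<forall>\<phi>\<in>Q. \<forall>i j. \<phi> i = u \<longrightarrow> {i, j} \<in> F \<longrightarrow>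
     (\<exists>\<psi>\<in>Q. \<psi> i = u \<and> {u, \<psi> j} \<in> R \<and> \<psi> j \<in> S))"

lemma settled_mono: "settled u S R \<Longrightarrow> S \<subseteq> S' \<Longrightarrow> R \<subseteq> R' \<Longrightarrow> settled u S' R'"
  unfolding settled_def by (meson subsetD)

lemma settled_explored:
  assumes "settled u S R" "S \<subseteq> verts K" "R \<subseteq> edges K" "\<forall>v\<in>S. explored K m v" "u \<in> S"
  shows "explored K (Suc m) u"
  using assms unfolding settled_def by (auto; blast)

text \<open>All visited vertices are answered outside an event whose probability is bounded by
  summing over the at most \<open>card C * d ^ j\<close> vertices of each later level.\<close>

lemma prob_explore_levels:
  assumes "\<delta> \<le> 1" "finite C" "C \<subseteq> S" "\<And>u. u \<in> S - C \<Longrightarrow> settled u S R"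
  shows "1 - k * (1 - \<delta>) ^ d * card C * (\<Sum>j<l. real d ^ j) \<le>
    measure_pmf.prob (explore_levels G d l S C R)
      {K. S \<subseteq> verts K \<and> R \<subseteq> edges K \<and> (\<forall>u\<in>S. explored K l u)}"
  using assms(2-4)
proof (induction l arbitrary: S C R)
  case 0
  then show ?case by (auto simp: indicator_def)
next
  case (Suc l)
  define \<beta> where "\<beta> = real k * (1 - \<delta>) ^ d"
  have \<beta>: "0 \<le> \<beta>" using assms(1) by (simp add: \<beta>_def)
  let ?p = "Pi_pmf C {} (query_answers G d)"
  let ?E = "{K. S \<subseteq> verts K \<and> R \<subseteq> edges K \<and> (\<forall>u\<in>S. explored K (Suc l) u)}"
  let ?P = "\<lambda>\<Gamma>. \<forall>u\<in>C. answered u (\<Gamma> u)"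
  have "measure_pmf.prob ?p {\<Gamma>. \<not> ?P \<Gamma>} = measure_pmf.prob ?p (\<Union>u\<in>C. {\<Gamma>. \<not> answered u (\<Gamma> u)})"
    by (rule arg_cong[of _ _ "measure_pmf.prob ?p"]) auto
  also have "\<dots> \<le> (\<Sum>u\<in>C. measure_pmf.prob ?p {\<Gamma>. \<not> answered u (\<Gamma> u)})"
    using Suc.prems(1) by (intro measure_pmf.finite_measure_subadditive_finite) auto
  also have "\<dots> \<le> (\<Sum>u\<in>C. \<beta>)"
  proof (rule sum_mono)
    fix u assume u: "u \<in> C"
    have "measure_pmf.prob ?p {\<Gamma>. \<not> answered u (\<Gamma> u)} =
        measure_pmf.prob (map_pmf (\<lambda>\<Gamma>. \<Gamma> u) ?p) {\<Gamma>. \<not> answered u \<Gamma>}"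
      by (simp add: vimage_def)
    also have "map_pmf (\<lambda>\<Gamma>. \<Gamma> u) ?p = query_answers G d u"
      using Pi_pmf_component[OF Suc.prems(1), of u "{}" "query_answers G d"] u by simp
    finally show "measure_pmf.prob ?p {\<Gamma>. \<not> answered u (\<Gamma> u)} \<le> \<beta>"
      using prob_not_answered[OF assms(1)] by (simp add: \<beta>_def)
  qed
  finally have bad: "measure_pmf.prob ?p {\<Gamma>. \<not> ?P \<Gamma>} \<le> \<beta> * card C" by (simp add: mult.commute)
  have "1 - \<beta> * card C - \<beta> * card C * d * (\<Sum>j<l. real d ^ j) \<le>
      measure_pmf.prob (explore_levels G d (Suc l) S C R) ?E"
    unfolding explore_levels.simps
  proof (rule prob_bind_pmf_ge[OF bad])
    show "0 \<le> \<beta> * card C * d * (\<Sum>j<l. real d ^ j)" using \<beta> by (simp add: sum_nonneg)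
    fix \<Gamma> assume \<Gamma>: "\<Gamma> \<in> set_pmf ?p" "?P \<Gamma>"
    define N where "N = (\<Union>u\<in>C. \<Gamma> u)"
    define R' where "R' = R \<union> {{u, x} |u x. u \<in> C \<and> x \<in> \<Gamma> u}"
    have G\<Gamma>: "finite (\<Gamma> u)" "card (\<Gamma> u) \<le> d" if "u \<in> C" for u
    proof -
      have "\<Gamma> u \<in> set_pmf (query_answers G d u)"
        using \<Gamma>(1) that Suc.prems(1) by (auto simp: set_Pi_pmf PiE_dflt_def)
      then show "finite (\<Gamma> u)" "card (\<Gamma> u) \<le> d" using set_query_answers[OF finite_neighbors] by auto
    qed
    have finN: "finite N" unfolding N_def using Suc.prems(1) G\<Gamma>(1) by blast
    have "card N \<le> (\<Sum>u\<in>C. card (\<Gamma> u))" unfolding N_def by (rule card_UN_le[OF Suc.prems(1)])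
    also have "\<dots> \<le> (\<Sum>u\<in>C. d)" using G\<Gamma>(2) by (rule sum_mono)
    finally have cN: "card N \<le> card C * d" by simp
    have "card (N - S) \<le> card N" using finN by (intro card_mono) auto
    with cN have "real (card (N - S)) \<le> card C * d" by (simp flip: of_nat_mult)
    then have "\<beta> * card (N - S) * (\<Sum>j<l. real d ^ j) \<le> \<beta> * (card C * d) * (\<Sum>j<l. real d ^ j)"
      using \<beta> by (intro mult_right_mono mult_left_mono) (auto simp: sum_nonneg)
    then have 1: "1 - \<beta> * card C * d * (\<Sum>j<l. real d ^ j) \<le> 1 - \<beta> * card (N - S) * (\<Sum>j<l. real d ^ j)"
      by (simp add: mult.assoc)
    \<comment> \<open>The frontier \<open>C\<close> has just been answered and the vertices before
      it were settled, so now all of \<open>S\<close> is settled and \<open>N - S\<close> is the new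
      frontier.\<close>
    have settled: "settled u (S \<union> N) R'" if "u \<in> S" for u
    proof (cases "u \<in> C")
      case True
      then have "answered u (\<Gamma> u)" using \<Gamma>(2) by blast
      moreover have "{u, x} \<in> R'" "x \<in> S \<union> N" if "x \<in> \<Gamma> u" for x
        using True that unfolding R'_def N_def by blast+
      ultimately show ?thesis unfolding answered_def settled_def by meson
    next
      case False
      have "settled u S R" using Suc.prems(3) that False by blast
      then show ?thesis by (rule settled_mono) (auto simp: R'_def)
    qed
    have "1 - \<beta> * card (N - S) * (\<Sum>j<l. real d ^ j) \<le>
        measure_pmf.prob (explore_levels G d l (S \<union> N) (N - S) R')
          {K. S \<union> N \<subseteq> verts K \<and> R' \<subseteq> edges K \<and> (\<forall>u\<in>S \<union> N. explored K l u)}"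
      unfolding \<beta>_def using finN settled by (intro Suc.IH) auto
    also have "\<dots> \<le> measure_pmf.prob (explore_levels G d l (S \<union> N) (N - S) R') ?E"
    proof (intro measure_pmf.finite_measure_mono subsetI)
      fix K assume "K \<in> {K. S \<union> N \<subseteq> verts K \<and> R' \<subseteq> edges K \<and> (\<forall>u\<in>S \<union> N. explored K l u)}"
      then have K: "S \<union> N \<subseteq> verts K" "R' \<subseteq> edges K" "\<forall>u\<in>S \<union> N. explored K l u" by simp_all
      have "explored K (Suc l) u" if "u \<in> S" for u
        using settled_explored[OF settled[OF that] K] that by blast
      moreover have "R \<subseteq> edges K" using K(2) by (auto simp: R'_def)
      ultimately show "K \<in> ?E" using K(1) by simp
    qed simp
    finally show "1 - \<beta> * card C * d * (\<Sum>j<l. real d ^ j) \<le>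
        measure_pmf.prob (explore_levels G d l (S \<union> (\<Union>u\<in>C. \<Gamma> u)) ((\<Union>u\<in>C. \<Gamma> u) - S)
          (R \<union> {{u, x} |u x. u \<in> C \<and> x \<in> \<Gamma> u})) ?E"
      using 1 unfolding N_def R'_def by linarith
  qed
  \<comment> \<open>Each frontier is at most \<open>d\<close> times as large as the one before,
    whence the geometric sum.\<close>
  moreover have "\<beta> * card C + \<beta> * card C * d * (\<Sum>j<l. real d ^ j) = \<beta> * card C * (\<Sum>j<Suc l. real d ^ j)"
  proof -
    have "(\<Sum>j<Suc l. real d ^ j) = 1 + d * (\<Sum>j<l. real d ^ j)"
      by (subst sum.lessThan_Suc_shift) (simp add: sum_distrib_left)
    then show ?thesis by (simp add: algebra_simps)
  qed
  ultimately show ?case unfolding \<beta>_def by linarith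
qed

lemma prob_traverse:
  assumes "\<delta> \<le> 1"
  shows "1 - k * (1 - \<delta>) ^ d * (\<Sum>j<l. real d ^ j) \<le> measure_pmf.prob (traverse G v d l) {K. explored K l v}"
proof -
  have "1 - k * (1 - \<delta>) ^ d * card {v} * (\<Sum>j<l. real d ^ j) \<le>
    measure_pmf.prob (explore_levels G d l {v} {v} {})
      {K. {v} \<subseteq> verts K \<and> {} \<subseteq> edges K \<and> (\<forall>u\<in>{v}. explored K l u)}"
    by (rule prob_explore_levels[OF assms]) auto
  also have "\<dots> \<le> measure_pmf.prob (traverse G v d l) {K. explored K l v}"
    unfolding traverse_def by (intro measure_pmf.finite_measure_mono) auto
  finally show ?thesis by simp
qed

end

section \<open>From distance to packings\<close>

lemma graph_iso_trans: "graph_iso G H \<Longrightarrow> graph_iso H K \<Longrightarrow> graph_iso G K"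
proof -
  assume GH: "graph_iso G H" and HK: "graph_iso H K"
  obtain \<phi> where \<phi>: "bij_betw \<phi> (verts G) (verts H)" "edges H = (\<lambda>e. \<phi> ` e) ` edges G"
    using GH unfolding graph_iso_def by (elim exE conjE)
  obtain \<psi> where \<psi>: "bij_betw \<psi> (verts H) (verts K)" "edges K = (\<lambda>e. \<psi> ` e) ` edges H"
    using HK unfolding graph_iso_def by (elim exE conjE)
  have "edges K = (\<lambda>e. (\<psi> \<circ> \<phi>) ` e) ` edges G"
    unfolding \<psi>(2) \<phi>(2) by (simp add: image_image)
  then show ?thesis
    unfolding graph_iso_def using bij_betw_trans[OF \<phi>(1) \<psi>(1)] by (intro exI conjI)
qed

lemma graph_iso_sym:
  assumes "graph_iso G H" and sub: "\<And>e. e \<in> edges G \<Longrightarrow> e \<subseteq> verts G"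
  shows "graph_iso H G"
proof -
  obtain \<phi> where \<phi>: "bij_betw \<phi> (verts G) (verts H)" "edges H = (\<lambda>e. \<phi> ` e) ` edges G"
    using assms(1) unfolding graph_iso_def by (elim exE conjE)
  let ?\<psi> = "inv_into (verts G) \<phi>"
  have "?\<psi> ` \<phi> ` e = e" if "e \<in> edges G" for e
    using \<phi>(1) sub[OF that] by (simp add: bij_betw_def inv_into_image_cancel)
  then have "edges G = (\<lambda>e. ?\<psi> ` e) ` edges H" unfolding \<phi>(2) by (simp add: image_image)
  then show ?thesis unfolding graph_iso_def using bij_betw_inv_into[OF \<phi>(1)] by (intro exI conjI)
qed

lemma contains_copy_mono:
  "contains_copy K H \<Longrightarrow> verts K \<subseteq> verts G \<Longrightarrow> edges K \<subseteq> edges G \<Longrightarrow> contains_copy G H"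
  unfolding contains_copy_def subgraph_of_def by blast

lemma contains_copyI:
  assumes iso: "graph_iso \<lparr>verts = V, edges = F\<rparr> H" and F: "simple_graph \<lparr>verts = V, edges = F\<rparr>"
    and \<theta>: "inj_on \<theta> V" "\<theta> ` V \<subseteq> verts K" "\<And>e. e \<in> F \<Longrightarrow> \<theta> ` e \<in> edges K"
  shows "contains_copy K H"
proof -
  let ?S = "\<lparr>verts = \<theta> ` V, edges = (\<lambda>e. \<theta> ` e) ` F\<rparr>"
  have e: "e \<subseteq> V" "card e = 2" if "e \<in> F" for e using F that by (auto simp: simple_graph_def)
  have "card (\<theta> ` e) = 2" if "e \<in> F" for e
    using e[OF that] card_image[OF inj_on_subset[OF \<theta>(1)]] by metis
  then have "simple_graph ?S" using F e(1) by (auto simp: simple_graph_def)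
  moreover have "graph_iso \<lparr>verts = V, edges = F\<rparr> ?S"
    using \<theta>(1) by (auto simp: graph_iso_def bij_betw_def)
  then have "graph_iso ?S H"
    using graph_iso_trans[OF graph_iso_sym iso] e(1) by simp
  moreover have "subgraph_of ?S K" using \<theta> calculation(1) by (auto simp: subgraph_of_def)
  ultimately show ?thesis unfolding contains_copy_def by blast
qed

text \<open>Labels will be forced by degrees, so copies in \<open>G\<close> realise several labelled
  versions of \<open>H\<close>. Inclusion in \<open>Pow {..<k}\<close> makes these finite in number,
  since \<open>graph_iso\<close> alone does not confine edges to the vertex set.\<close>

definition patterns :: "'b ugraph \<Rightarrow> nat \<Rightarrow> nat set set set" where
  "patterns H k = {F. F \<subseteq> Pow {..<k} \<and> graph_iso \<lparr>verts = {..<k}, edges = F\<rparr> H}"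

lemma pattern_simple_connected:
  assumes F: "F \<in> patterns H k" and H: "simple_graph H" "connected_graph H"
  shows "simple_graph \<lparr>verts = {..<k}, edges = F\<rparr>" "connected_in F {..<k}"
proof -
  obtain \<phi> where \<phi>: "bij_betw \<phi> {..<k} (verts H)" "edges H = (\<lambda>e. \<phi> ` e) ` F"
    and sub: "\<And>e. e \<in> F \<Longrightarrow> e \<subseteq> {..<k}"
    using F by (auto simp: patterns_def graph_iso_def)
  have inj: "inj_on \<phi> {..<k}" using \<phi>(1) by (simp add: bij_betw_def)
  have "card e = 2" if "e \<in> F" for e
  proof -
    have "card (\<phi> ` e) = 2" using H(1) \<phi>(2) that by (simp add: simple_graph_def)
    then show ?thesis using card_image[OF inj_on_subset[OF inj sub[OF that]]] by simp
  qed
  then show "simple_graph \<lparr>verts = {..<k}, edges = F\<rparr>" using sub by (auto simp: simple_graph_def)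
  let ?R = "{(a, b). {a, b} \<in> F \<and> a \<in> {..<k} \<and> b \<in> {..<k}}"
  let ?\<psi> = "inv_into {..<k} \<phi>"
  have \<psi>: "?\<psi> a \<in> {..<k}" "\<phi> (?\<psi> a) = a" if "a \<in> verts H" for a
    using \<phi>(1) that inv_into_into[of a \<phi> "{..<k}"] f_inv_into_f[of a \<phi> "{..<k}"]
    by (simp_all add: bij_betw_def)
  have path: "(?\<psi> a, ?\<psi> b) \<in> ?R\<^sup>*"
    if "(a, b) \<in> {(x, y). {x, y} \<in> edges H}\<^sup>*" for a b
    using that
  proof induction
    case (step b c)
    then have bc: "{b, c} \<in> edges H" by simp
    note v = simple_graph_edgeD(2,3)[OF H(1) bc]
    obtain e where e: "e \<in> F" "{b, c} = \<phi> ` e" using bc \<phi>(2) by blast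
    have "\<phi> ` {?\<psi> b, ?\<psi> c} = \<phi> ` e" using e(2) \<psi>(2)[OF v(1)] \<psi>(2)[OF v(2)] by simp
    moreover have "{?\<psi> b, ?\<psi> c} \<subseteq> {..<k}" using \<psi>(1) v by blast
    ultimately have "{?\<psi> b, ?\<psi> c} = e"
      using inj_on_image_eq_iff[OF inj _ sub[OF e(1)]] by blast
    then have "(?\<psi> b, ?\<psi> c) \<in> ?R" using e(1) \<psi>(1) v by blast
    then show ?case by (rule rtrancl_into_rtrancl[OF step.IH])
  qed simp
  show "connected_in F {..<k}"
    unfolding connected_in_def
  proof (intro ballI)
    fix i j assume ij: "i \<in> {..<k}" "j \<in> {..<k}"
    then have "\<phi> i \<in> verts H" "\<phi> j \<in> verts H" using \<phi>(1) by (auto simp: bij_betw_def)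
    then have "(?\<psi> (\<phi> i), ?\<psi> (\<phi> j)) \<in> ?R\<^sup>*" using path H(2) unfolding connected_graph_def by blast
    then show "(i, j) \<in> ?R\<^sup>*" using ij inj by simp
  qed
qed

definition labelled_copies :: "'a ugraph \<Rightarrow> 'b ugraph \<Rightarrow> nat \<Rightarrow> ((nat \<Rightarrow> 'a) \<times> nat set set) set" where
  "labelled_copies G H k = {(\<phi>, F). \<phi> \<in> {..<k} \<rightarrow>\<^sub>E verts G \<and> F \<in> patterns H k \<and> inj_on \<phi> {..<k} \<and>
     (\<forall>e\<in>F. \<phi> ` e \<in> edges G) \<and> (\<forall>i j. i \<le> j \<longrightarrow> j < k \<longrightarrow> deg G (\<phi> i) \<le> deg G (\<phi> j))}"

lemma finite_patterns: "finite (patterns H k)"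
  by (rule finite_subset[of _ "Pow (Pow {..<k})"]) (auto simp: patterns_def)

lemma card_patterns_le: "card (patterns H k) \<le> 2 ^ (2 ^ k)"
proof -
  have "card (patterns H k) \<le> card (Pow (Pow {..<k}))"
    by (rule card_mono) (auto simp: patterns_def)
  then show ?thesis by (simp add: card_Pow)
qed

lemma finite_labelled_copies:
  assumes "finite (verts G)"
  shows "finite (labelled_copies G H k)"
  by (rule finite_subset[of _ "({..<k} \<rightarrow>\<^sub>E verts G) \<times> patterns H k"])
    (use assms in \<open>auto simp: labelled_copies_def intro!: finite_PiE finite_patterns\<close>)

text \<open>Listing the vertices of \<open>S\<close> by increasing degree in \<open>G\<close> gives
  the labels; the pattern consists of the preimages of the edges of \<open>S\<close>.\<close>

lemma ex_labelled_copy: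
  assumes S: "subgraph_of S G" "graph_iso S H" and k: "k = card (verts H)" and fin: "finite (verts G)"
  shows "\<exists>\<phi> F. (\<phi>, F) \<in> labelled_copies G H k \<and> (\<forall>e\<in>F. \<phi> ` e \<in> edges S)"
proof -
  have sS: "simple_graph S" "verts S \<subseteq> verts G" "edges S \<subseteq> edges G"
    using S(1) by (auto simp: subgraph_of_def)
  have finS: "finite (verts S)" using sS(2) fin by (rule finite_subset)
  have cS: "card (verts S) = k" using S(2) k by (auto simp: graph_iso_def bij_betw_same_card)
  obtain ys where ys: "set ys = verts S" "distinct ys" using finite_distinct_list[OF finS] by blast
  define xs where "xs = sort_key (deg G) ys"
  have xs: "set xs = verts S" "distinct xs" "length xs = k" "sorted (map (deg G) xs)"
    using ys cS distinct_card[of ys] by (auto simp: xs_def)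
  define \<phi> where "\<phi> = (\<lambda>i\<in>{..<k}. xs ! i)"
  have \<phi>: "\<phi> i = xs ! i" if "i < k" for i using that by (simp add: \<phi>_def)
  have inj: "inj_on \<phi> {..<k}"
    using xs(2,3) by (intro inj_onI) (simp add: \<phi> nth_eq_iff_index_eq)
  have im: "\<phi> ` {..<k} = verts S"
  proof -
    have "\<phi> ` {..<k} = (\<lambda>i. xs ! i) ` {..<k}" using \<phi> by (intro image_cong) auto
    then show ?thesis using xs(1,3) by (auto simp: set_conv_nth)
  qed
  define F where "F = {e. e \<subseteq> {..<k} \<and> \<phi> ` e \<in> edges S}"
  have "edges S = (\<lambda>e. \<phi> ` e) ` F"
  proof
    show "edges S \<subseteq> (\<lambda>e. \<phi> ` e) ` F"
    proof
      fix e assume e: "e \<in> edges S"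
      then have "e \<subseteq> \<phi> ` {..<k}" using sS(1) im by (auto simp: simple_graph_def)
      then obtain e' where "e' \<subseteq> {..<k}" "e = \<phi> ` e'" by (auto simp: subset_image_iff)
      then show "e \<in> (\<lambda>e. \<phi> ` e) ` F" using e by (auto simp: F_def)
    qed
  qed (auto simp: F_def)
  then have "graph_iso \<lparr>verts = {..<k}, edges = F\<rparr> S"
    using inj im by (auto simp: graph_iso_def bij_betw_def)
  then have "F \<in> patterns H k"
    using graph_iso_trans S(2) by (auto simp: patterns_def F_def)
  moreover have "\<phi> \<in> {..<k} \<rightarrow>\<^sub>E verts G"
    using im sS(2) by (auto simp: \<phi>_def)
  moreover have "deg G (\<phi> i) \<le> deg G (\<phi> j)" if "i \<le> j" "j < k" for i j
    using sorted_nth_mono[OF xs(4), of i j] that xs(3) by (simp add: \<phi>)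
  ultimately have "(\<phi>, F) \<in> labelled_copies G H k"
    using inj sS(3) by (auto simp: labelled_copies_def F_def)
  then show ?thesis by (auto simp: F_def)
qed

text \<open>Take an edge-disjoint family with the most members. Deleting the set \<open>D\<close> of
  all its edges leaves no copy, so \<open>D\<close> is large, while one copy has at most
  \<open>2 ^ k\<close> edges, counted crudely as subsets of \<open>{..<k}\<close>.\<close>

lemma far_many_copies:
  assumes far: "far_from_free \<epsilon> G H" and G: "simple_graph G"
    and H: "simple_graph H" "connected_graph H" and k: "k = card (verts H)" "2 \<le> k"
  shows "\<exists>M\<subseteq>labelled_copies G H k. \<epsilon> * card (verts G) \<le> 2 ^ k * card M \<and>
    (\<forall>(\<phi>, F)\<in>M. \<forall>(\<psi>, F')\<in>M. (\<phi>, F) \<noteq> (\<psi>, F') \<longrightarrow> (\<forall>e\<in>F. \<forall>e'\<in>F'. \<phi> ` e \<noteq> \<psi> ` e'))"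
proof -
  let ?W = "labelled_copies G H k"
  define ed where "ed p = (\<lambda>e. fst p ` e) ` snd p" for p :: "(nat \<Rightarrow> 'a) \<times> nat set set"
  define good where "good M \<longleftrightarrow> M \<subseteq> ?W \<and> (\<forall>p\<in>M. \<forall>p'\<in>M. p \<noteq> p' \<longrightarrow> ed p \<inter> ed p' = {})" for M
  have finG: "finite (verts G)" using G by (simp add: simple_graph_def)
  have finW: "finite ?W" using finG by (rule finite_labelled_copies)
  have "finite {M. good M}" using finW by (rule finite_subset[rotated, OF finite_Pow_iff[THEN iffD2]]) (auto simp: good_def)
  moreover have "good {}" by (simp add: good_def)
  ultimately obtain M where M: "good M" and max: "\<And>M'. good M' \<Longrightarrow> card M' \<le> card M"
    using finite_has_maximiser[of "{M. good M}" card] by blast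
  have finM: "finite M" using M finW by (auto simp: good_def intro: finite_subset)
  define D where "D = (\<Union>p\<in>M. ed p)"
  \<comment> \<open>Patterns have an edge, so a copy that is edge-disjoint from all members of
    \<open>M\<close> cannot itself be a member.\<close>
  have ne: "F \<noteq> {}" if "F \<in> patterns H k" for F
  proof -
    have "0 \<in> {..<k}" "1 \<in> {..<k}" using k(2) by auto
    then have "\<exists>u\<in>{..<k}. \<exists>v\<in>{..<k}. {u, v} \<in> F"
      by (rule connected_in_edge[OF pattern_simple_connected(2)[OF that H]]) simp
    then show ?thesis by blast
  qed
  have "D \<subseteq> edges G" using M by (auto simp: D_def ed_def good_def labelled_copies_def)
  moreover have "subgraph_free (delete_edges G D) H"
  proof (rule ccontr)
    assume "\<not> subgraph_free (delete_edges G D) H"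
    then obtain S where S: "subgraph_of S (delete_edges G D)" "graph_iso S H"
      by (auto simp: subgraph_free_def contains_copy_def)
    then have "subgraph_of S G" by (auto simp: subgraph_of_def delete_edges_def)
    then obtain \<phi> F where \<phi>: "(\<phi>, F) \<in> ?W" "\<forall>e\<in>F. \<phi> ` e \<in> edges S"
      using ex_labelled_copy[OF _ S(2) k(1) finG] by blast
    have "ed (\<phi>, F) \<inter> D = {}"
      using \<phi>(2) S(1) by (auto simp: ed_def subgraph_of_def delete_edges_def)
    then have disj: "ed (\<phi>, F) \<inter> ed p = {}" if "p \<in> M" for p using that by (auto simp: D_def)
    have "F \<in> patterns H k" using \<phi>(1) by (simp add: labelled_copies_def)
    then have "ed (\<phi>, F) \<noteq> {}" using ne by (simp add: ed_def)
    then have notin: "(\<phi>, F) \<notin> M" using disj by blast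
    have "good (insert (\<phi>, F) M)"
      unfolding good_def
    proof (intro conjI ballI impI)
      show "insert (\<phi>, F) M \<subseteq> ?W" using M \<phi>(1) by (simp add: good_def)
      fix p p' assume "p \<in> insert (\<phi>, F) M" "p' \<in> insert (\<phi>, F) M" "p \<noteq> p'"
      then consider "p = (\<phi>, F)" "p' \<in> M" | "p' = (\<phi>, F)" "p \<in> M" | "p \<in> M" "p' \<in> M" by blast
      then show "ed p \<inter> ed p' = {}"
      proof cases
        case 1
        then show ?thesis using disj by simp
      next
        case 2
        then show ?thesis using disj by (simp add: Int_commute)
      next
        case 3
        then show ?thesis using M \<open>p \<noteq> p'\<close> by (simp add: good_def)
      qed
    qed
    then have "card (insert (\<phi>, F) M) \<le> card M" by (rule max)
    then show False using notin finM by simp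
  qed
  ultimately have "\<epsilon> * card (verts G) < card D" using far by (simp add: far_from_free_def)
  moreover have "card D \<le> 2 ^ k * card M"
  proof -
    have "card D \<le> (\<Sum>p\<in>M. card (ed p))" unfolding D_def using finM by (rule card_UN_le)
    also have "\<dots> \<le> (\<Sum>p\<in>M. 2 ^ k)"
    proof (rule sum_mono)
      fix p assume "p \<in> M"
      then have "snd p \<in> patterns H k" using M by (auto simp: good_def labelled_copies_def)
      then have sub: "snd p \<subseteq> Pow {..<k}" by (simp add: patterns_def)
      then have "card (ed p) \<le> card (snd p)"
        unfolding ed_def by (intro card_image_le) (rule finite_subset, auto)
      also have "\<dots> \<le> card (Pow {..<k})" using sub by (intro card_mono) auto
      also have "\<dots> = 2 ^ k" by (simp add: card_Pow)
      finally show "card (ed p) \<le> 2 ^ k" .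
    qed
    finally show ?thesis by (simp add: mult.commute)
  qed
  then have "real (card D) \<le> 2 ^ k * card M" by (metis of_nat_le_iff of_nat_mult of_nat_numeral of_nat_power)
  ultimately have "\<epsilon> * card (verts G) \<le> 2 ^ k * card M" by simp
  moreover have "\<phi> ` e \<noteq> \<psi> ` e'" if "(\<phi>, F) \<in> M" "(\<psi>, F') \<in> M" "(\<phi>, F) \<noteq> (\<psi>, F')" "e \<in> F" "e' \<in> F'"
    for \<phi> F \<psi> F' e e'
  proof -
    have "ed (\<phi>, F) \<inter> ed (\<psi>, F') = {}" using M that(1-3) by (simp add: good_def)
    moreover have "\<phi> ` e \<in> ed (\<phi>, F)" "\<psi> ` e' \<in> ed (\<psi>, F')" using that(4,5) by (simp_all add: ed_def)
    ultimately show ?thesis by fastforce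
  qed
  moreover have "M \<subseteq> ?W" using M by (simp add: good_def)
  ultimately show ?thesis by (intro exI[of _ M]) blast
qed

section \<open>Passing to a single pattern and a colouring\<close>

lemma pigeonhole:
  assumes "finite M" "g ` M \<subseteq> T" "finite T" "T \<noteq> {}"
  shows "\<exists>t\<in>T. card M \<le> card T * card {x \<in> M. g x = t}"
proof -
  obtain t where t: "t \<in> T" "\<And>s. s \<in> T \<Longrightarrow> card {x \<in> M. g x = s} \<le> card {x \<in> M. g x = t}"
    using finite_has_maximiser[OF assms(3,4), of "\<lambda>t. card {x \<in> M. g x = t}"] by blast
  have "card M = (\<Sum>s\<in>g ` M. card {x \<in> M. g x = s})" by (rule card_eq_sum_fibres[OF assms(1)])
  also have "\<dots> \<le> (\<Sum>s\<in>T. card {x \<in> M. g x = s})" using assms by (intro sum_mono2) auto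
  also have "\<dots> \<le> (\<Sum>s\<in>T. card {x \<in> M. g x = t})" using t(2) by (rule sum_mono)
  finally show ?thesis using t(1) by auto
qed

text \<open>Average over all colourings of \<open>V\<close>: each map is coloured correctly by a
  fraction \<open>1 / k ^ k\<close> of them.\<close>

lemma ex_colouring:
  assumes Q: "finite Q" "\<And>\<phi>. \<phi> \<in> Q \<Longrightarrow> inj_on \<phi> {..<k}" "\<And>\<phi>. \<phi> \<in> Q \<Longrightarrow> \<phi> ` {..<k} \<subseteq> V"
    and V: "finite V" and k: "0 < k"
  shows "\<exists>c. card Q \<le> k ^ k * card {\<phi> \<in> Q. \<forall>i<k. c (\<phi> i) = i}"
proof -
  let ?X = "V \<rightarrow>\<^sub>E {..<k}"
  define P where "P c \<phi> \<longleftrightarrow> (\<forall>i<k. c (\<phi> i) = i)" for c :: "'a \<Rightarrow> nat" and \<phi>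
  have finX: "finite ?X" using V by (intro finite_PiE) auto
  have cX: "card ?X = k ^ card V" using V by (simp add: card_PiE)
  have "?X \<noteq> {}" using k by (auto simp: PiE_eq_empty_iff)
  then obtain c where c: "c \<in> ?X" "\<And>c'. c' \<in> ?X \<Longrightarrow> card {\<phi> \<in> Q. P c' \<phi>} \<le> card {\<phi> \<in> Q. P c \<phi>}"
    using finite_has_maximiser[OF finX, of "\<lambda>c. card {\<phi> \<in> Q. P c \<phi>}"] by blast
  have ext: "card {c \<in> ?X. P c \<phi>} * k ^ k = k ^ card V" if \<phi>: "\<phi> \<in> Q" for \<phi>
  proof -
    let ?I = "\<phi> ` {..<k}" and ?\<psi> = "inv_into {..<k} \<phi>"
    have inj: "inj_on \<phi> {..<k}" and sub: "?I \<subseteq> V" using Q(2,3) \<phi> by auto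
    have "{c \<in> ?X. P c \<phi>} = (\<Pi>\<^sub>E v\<in>V. if v \<in> ?I then {?\<psi> v} else {..<k})" (is "_ = ?Y")
    proof (intro equalityI subsetI)
      fix c assume c: "c \<in> {c \<in> ?X. P c \<phi>}"
      show "c \<in> ?Y"
      proof (rule PiE_I)
        fix v assume "v \<in> V"
        show "c v \<in> (if v \<in> ?I then {?\<psi> v} else {..<k})"
          using c inj \<open>v \<in> V\<close> by (auto simp: P_def)
      qed (use c in auto)
    next
      fix c assume c: "c \<in> ?Y"
      have "c (\<phi> i) = i" if "i < k" for i
      proof -
        have "\<phi> i \<in> V" "\<phi> i \<in> ?I" using sub that by auto
        then have "c (\<phi> i) = ?\<psi> (\<phi> i)" using PiE_mem[OF c, of "\<phi> i"] by simp
        then show ?thesis using inj that by simp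
      qed
      moreover have "c v < k" if "v \<in> V" for v
        using PiE_mem[OF c that] by (cases "v \<in> ?I") (auto simp: inj)
      ultimately show "c \<in> {c \<in> ?X. P c \<phi>}" using c by (auto simp: P_def PiE_iff)
    qed
    then have "card {c \<in> ?X. P c \<phi>} = (\<Prod>v\<in>V. card (if v \<in> ?I then {?\<psi> v} else {..<k}))"
      using card_PiE[OF V] by simp
    also have "\<dots> = (\<Prod>v\<in>V. if v \<in> ?I then 1 else k)" by (rule prod.cong) auto
    also have "\<dots> = k ^ card (V - ?I)"
      using V by (simp add: prod.If_cases Diff_eq)
    finally have "card {c \<in> ?X. P c \<phi>} * k ^ k = k ^ (card (V - ?I) + k)" by (simp add: power_add)
    also have "card (V - ?I) + k = card V"
      using card_image[OF inj] card_Diff_subset[of ?I V] card_mono[OF V sub] sub by simp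
    finally show ?thesis .
  qed
  have "card Q * k ^ card V = (\<Sum>\<phi>\<in>Q. card {c \<in> ?X. P c \<phi>}) * k ^ k"
    using ext by (simp add: sum_distrib_right)
  also have "(\<Sum>\<phi>\<in>Q. card {c \<in> ?X. P c \<phi>}) = (\<Sum>c\<in>?X. card {\<phi> \<in> Q. P c \<phi>})"
  proof -
    have "(\<Sum>\<phi>\<in>Q. card {c \<in> ?X. P c \<phi>}) = (\<Sum>\<phi>\<in>Q. \<Sum>c\<in>?X. if P c \<phi> then 1 else 0)"
      using finX by (simp flip: sum.inter_filter)
    also have "\<dots> = (\<Sum>c\<in>?X. \<Sum>\<phi>\<in>Q. if P c \<phi> then 1 else 0)" by (rule sum.swap)
    finally show ?thesis using Q(1) by (simp flip: sum.inter_filter)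
  qed
  also have "\<dots> \<le> (\<Sum>c'\<in>?X. card {\<phi> \<in> Q. P c \<phi>})" using c(2) by (rule sum_mono)
  also have "\<dots> = k ^ card V * card {\<phi> \<in> Q. P c \<phi>}" using cX by simp
  finally have "card Q * k ^ card V \<le> k ^ k * card {\<phi> \<in> Q. P c \<phi>} * k ^ card V"
    by (simp add: mult_ac)
  then have "card Q \<le> k ^ k * card {\<phi> \<in> Q. P c \<phi>}" using k by simp
  then show ?thesis unfolding P_def by blast
qed

text \<open>The three factors in the denominator are the bounds for the edges of a copy, for the
  number of patterns, and for the loss by colour coding.\<close>

lemma far_packing:
  assumes far: "far_from_free \<epsilon> G H" and G: "simple_graph G"
    and H: "simple_graph H" "connected_graph H" and k: "k = card (verts H)" "2 \<le> k"
  shows "\<exists>F\<in>patterns H k. \<exists>Q. packing G k F Q \<and>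
    \<epsilon> / (2 ^ k * 2 ^ (2 ^ k) * k ^ k) * card (verts G) \<le> card Q"
proof -
  have finG: "finite (verts G)" using G by (simp add: simple_graph_def)
  obtain M where M: "M \<subseteq> labelled_copies G H k" "\<epsilon> * card (verts G) \<le> 2 ^ k * card M"
    and disj: "\<And>\<phi> F \<psi> F' e e'. (\<phi>, F) \<in> M \<Longrightarrow> (\<psi>, F') \<in> M \<Longrightarrow> (\<phi>, F) \<noteq> (\<psi>, F') \<Longrightarrow> e \<in> F \<Longrightarrow> e' \<in> F' \<Longrightarrow>
      \<phi> ` e \<noteq> \<psi> ` e'"
    using far_many_copies[OF assms] by fastforce
  have finM: "finite M" using M(1) finite_labelled_copies[OF finG] by (rule finite_subset)
  have sub: "snd ` M \<subseteq> patterns H k" using M(1) by (auto simp: labelled_copies_def)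
  \<comment> \<open>The pigeonhole needs some pattern even if \<open>M\<close> is empty;
    \<open>H\<close> as a copy in itself supplies one.\<close>
  have "patterns H k \<noteq> {}"
  proof -
    have fin: "finite (verts H)" using H(1) by (simp add: simple_graph_def)
    moreover have "subgraph_of H H" using H(1) by (simp add: subgraph_of_def)
    moreover have "graph_iso H H" by (auto simp: graph_iso_def intro!: exI[of _ id])
    ultimately obtain \<phi> F where "(\<phi>, F) \<in> labelled_copies H H k" using ex_labelled_copy k(1) by blast
    then show ?thesis by (auto simp: labelled_copies_def)
  qed
  then obtain F where F: "F \<in> patterns H k" "card M \<le> card (patterns H k) * card {p \<in> M. snd p = F}"
    using pigeonhole[OF finM sub finite_patterns] by blast
  define Q1 where "Q1 = {\<phi>. (\<phi>, F) \<in> M}"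
  have "{p \<in> M. snd p = F} = (\<lambda>\<phi>. (\<phi>, F)) ` Q1" by (auto simp: Q1_def)
  then have cQ1: "card {p \<in> M. snd p = F} = card Q1" by (simp add: card_image inj_on_def)
  have "Q1 \<subseteq> fst ` M" by (force simp: Q1_def)
  then have finQ1: "finite Q1" using finM by (auto intro: finite_subset)
  have Q1: "\<phi> \<in> {..<k} \<rightarrow>\<^sub>E verts G" "inj_on \<phi> {..<k}" "\<And>e. e \<in> F \<Longrightarrow> \<phi> ` e \<in> edges G"
    "\<And>i j. i \<le> j \<Longrightarrow> j < k \<Longrightarrow> deg G (\<phi> i) \<le> deg G (\<phi> j)" if "\<phi> \<in> Q1" for \<phi>
    using that M(1) by (auto simp: Q1_def labelled_copies_def)
  have "\<phi> ` {..<k} \<subseteq> verts G" if "\<phi> \<in> Q1" for \<phi> using Q1(1)[OF that] by auto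
  then obtain c where c: "card Q1 \<le> k ^ k * card {\<phi> \<in> Q1. \<forall>i<k. c (\<phi> i) = i}"
    using ex_colouring[OF finQ1 Q1(2) _ finG] k(2) by auto
  define Q where "Q = {\<phi> \<in> Q1. \<forall>i<k. c (\<phi> i) = i}"
  have QQ1: "\<phi> \<in> Q1" "\<And>i. i < k \<Longrightarrow> c (\<phi> i) = i" if "\<phi> \<in> Q" for \<phi> using that by (auto simp: Q_def)
  have "packing G k F Q"
  proof (unfold_locales, fact G, fact pattern_simple_connected(1)[OF F(1) H],
      fact pattern_simple_connected(2)[OF F(1) H], fact k(2))
    show "finite Q" using finQ1 by (simp add: Q_def)
    fix \<phi> i j assume \<phi>: "\<phi> \<in> Q"
    note Q1' = Q1[OF QQ1(1)[OF \<phi>]]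
    show "i < k \<Longrightarrow> \<phi> i \<in> verts G" using Q1'(1) by auto
    show "{i, j} \<in> F \<Longrightarrow> {\<phi> i, \<phi> j} \<in> edges G" using Q1'(3)[of "{i, j}"] by simp
    show "i \<le> j \<Longrightarrow> j < k \<Longrightarrow> deg G (\<phi> i) \<le> deg G (\<phi> j)" by (rule Q1'(4))
    fix \<psi> assume \<psi>: "\<psi> \<in> Q"
    show "i = j" if "i < k" "j < k" "\<phi> i = \<psi> j"
      using QQ1(2)[OF \<phi> that(1)] QQ1(2)[OF \<psi> that(2)] that(3) by simp
    show "\<phi> = \<psi>" if "{i, j} \<in> F" "\<phi> i = \<psi> i" "\<phi> j = \<psi> j"
    proof (rule ccontr)
      assume "\<phi> \<noteq> \<psi>"
      then have "\<phi> ` {i, j} \<noteq> \<psi> ` {i, j}"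
        using QQ1(1)[OF \<phi>] QQ1(1)[OF \<psi>] that(1) by (intro disj[of _ F _ F]) (auto simp: Q1_def)
      then show False using that(2,3) by simp
    qed
  qed
  moreover have "\<epsilon> / (2 ^ k * 2 ^ (2 ^ k) * k ^ k) * card (verts G) \<le> card Q"
  proof -
    have "card M \<le> 2 ^ (2 ^ k) * (k ^ k * card Q)"
      using F(2) c card_patterns_le[of H k] unfolding cQ1 Q_def[symmetric]
      by (meson mult_le_mono order_trans)
    then have "real (card M) \<le> 2 ^ (2 ^ k) * (real k ^ k * card Q)"
      by (metis of_nat_le_iff of_nat_mult of_nat_numeral of_nat_power)
    then have "2 ^ k * real (card M) \<le> 2 ^ k * (2 ^ (2 ^ k) * (real k ^ k * card Q))"
      by (rule mult_left_mono) simp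
    moreover have "\<epsilon> * card (verts G) \<le> 2 ^ k * real (card M)" using M(2) by simp
    ultimately have "\<epsilon> * card (verts G) \<le> 2 ^ k * (2 ^ (2 ^ k) * (real k ^ k * card Q))"
      by (rule order_trans[rotated])
    then have "\<epsilon> * card (verts G) \<le> 2 ^ k * 2 ^ (2 ^ k) * real k ^ k * card Q" by (simp only: mult.assoc)
    then show ?thesis using k(2) by (simp add: field_simps)
  qed
  ultimately show ?thesis using F(1) by blast
qed

section \<open>The tester\<close>

text \<open>With \<open>b\<close> the \<open>l\<close>-th root of \<open>a\<close>, the terms are
  the \<open>l\<close>-th powers of \<open>d * b ^ d\<close>.\<close>

lemma tendsto_power_times_geometric:
  fixes a :: real
  assumes "0 \<le> a" "a < 1" "0 < l"
  shows "(\<lambda>d. real d ^ l * a ^ d) \<longlonglongrightarrow> 0"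
proof -
  define b where "b = root l a"
  have b: "0 \<le> b" "b < 1" "b ^ l = a"
    using assms by (auto simp: b_def)
  have "(\<lambda>d. (of_nat d * b ^ d) ^ l) \<longlonglongrightarrow> 0 ^ l"
    using b by (intro tendsto_power powser_times_n_limit_0) simp
  moreover have "(of_nat d * b ^ d) ^ l = real d ^ l * a ^ d" for d
  proof -
    have "(b ^ d) ^ l = (b ^ l) ^ d" by (metis power_mult mult.commute)
    then show ?thesis using b(3) by (simp add: power_mult_distrib)
  qed
  ultimately show ?thesis using assms(3) by (simp add: power_0_left)
qed

text \<open>The number of visited vertices is polynomial in \<open>d\<close>, but the failure
  probability at each of them is exponentially small.\<close>

lemma ex_query_number:
  fixes \<delta> :: real and k l :: nat
  assumes "0 < \<delta>" "\<delta> \<le> 1" "0 < l"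
  shows "\<exists>d>0. k * (1 - \<delta>) ^ d * (\<Sum>j<l. real d ^ j) \<le> 1 / 2"
proof -
  have "(\<lambda>d. real k * real l * (real d ^ l * (1 - \<delta>) ^ d)) \<longlonglongrightarrow> real k * real l * 0"
    using assms by (intro tendsto_mult tendsto_const tendsto_power_times_geometric) auto
  then have "\<forall>\<^sub>F d in sequentially. real k * real l * (real d ^ l * (1 - \<delta>) ^ d) < 1 / 2"
    by (rule order_tendstoD) simp
  then have "\<forall>\<^sub>F d in sequentially. real k * real l * (real d ^ l * (1 - \<delta>) ^ d) < 1 / 2 \<and> 0 < d"
    using eventually_gt_at_top by (rule eventually_conj)
  then obtain d where d: "real k * real l * (real d ^ l * (1 - \<delta>) ^ d) < 1 / 2" "0 < d"
    using eventually_happens by force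
  have "(\<Sum>j<l. real d ^ j) \<le> (\<Sum>j<l. real d ^ l)"
    using d(2) by (intro sum_mono power_increasing) auto
  then have "k * (1 - \<delta>) ^ d * (\<Sum>j<l. real d ^ j) \<le> k * (1 - \<delta>) ^ d * (real l * real d ^ l)"
    using assms by (intro mult_left_mono) auto
  also have "\<dots> = real k * real l * (real d ^ l * (1 - \<delta>) ^ d)" by (simp add: mult_ac)
  finally have "k * (1 - \<delta>) ^ d * (\<Sum>j<l. real d ^ j) \<le> 1 / 2" using d(1) by simp
  then show ?thesis using d(2) by blast
qed

text \<open>The rounds are independent, and acceptance means that each of them misses
  \<open>H\<close>.\<close>

lemma pmf_rbe_rounds_Accept:
  "pmf (rbe_rounds m d l G H) Accept =
     measure_pmf.prob (bind_pmf (pmf_of_set (verts G)) (\<lambda>v. traverse G v d l)) {K. \<not> contains_copy K H} ^ m"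
proof (induction m)
  case 0
  then show ?case by simp
next
  case (Suc m)
  let ?t = "bind_pmf (pmf_of_set (verts G)) (\<lambda>v. traverse G v d l)"
  let ?a = "pmf (rbe_rounds m d l G H) Accept"
  have "rbe_rounds (Suc m) d l G H =
      bind_pmf ?t (\<lambda>K. if contains_copy K H then return_pmf Reject else rbe_rounds m d l G H)"
    by (simp add: bind_assoc_pmf)
  then have "pmf (rbe_rounds (Suc m) d l G H) Accept =
      (\<integral>K. pmf (if contains_copy K H then return_pmf Reject else rbe_rounds m d l G H) Accept \<partial>measure_pmf ?t)"
    by (simp only: pmf_bind)
  also have "\<dots> = (\<integral>K. indicator {K. \<not> contains_copy K H} K * ?a \<partial>measure_pmf ?t)"
    by (intro Bochner_Integration.integral_cong refl) (simp add: indicator_def)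
  also have "\<dots> = measure_pmf.prob ?t {K. \<not> contains_copy K H} * ?a" by simp
  finally show ?case using Suc.IH by simp
qed

lemma pmf_Reject: "pmf p Reject = 1 - pmf p Accept"
proof -
  have "v \<in> {Accept, Reject}" for v by (cases v) simp_all
  then have "set_pmf p \<subseteq> {Accept, Reject}" by (intro subsetI)
  then have "(\<Sum>v\<in>{Accept, Reject}. pmf p v) = 1" by (intro sum_pmf_eq_1) simp
  then show ?thesis by simp
qed

lemma set_explore_levels:
  assumes G: "simple_graph G" and "C \<subseteq> S" "S \<subseteq> verts G" "R \<subseteq> edges G"
    and "K \<in> set_pmf (explore_levels G d l S C R)"
  shows "S \<subseteq> verts K \<and> verts K \<subseteq> verts G \<and> edges K \<subseteq> edges G"
  using assms(2-)
proof (induction l arbitrary: S C R)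
  case 0
  then show ?case by simp
next
  case (Suc l)
  note edge = simple_graph_edgeD[OF G]
  have finG: "finite (verts G)" using G by (simp add: simple_graph_def)
  have nb: "neighbors G u \<subseteq> verts G" for u using edge by (auto simp: neighbors_def)
  have finC: "finite C" using Suc.prems finG by (meson finite_subset)
  obtain \<Gamma> where \<Gamma>: "\<Gamma> \<in> set_pmf (Pi_pmf C {} (query_answers G d))"
    and K: "K \<in> set_pmf (explore_levels G d l (S \<union> (\<Union>u\<in>C. \<Gamma> u)) ((\<Union>u\<in>C. \<Gamma> u) - S)
      (R \<union> {{u, x} |u x. u \<in> C \<and> x \<in> \<Gamma> u}))"
    using Suc.prems(4) by auto
  have \<Gamma>N: "\<Gamma> u \<subseteq> neighbors G u" if "u \<in> C" for u
  proof -
    have "\<Gamma> u \<in> set_pmf (query_answers G d u)"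
      using \<Gamma> that finC by (auto simp: set_Pi_pmf PiE_dflt_def)
    then show ?thesis using set_query_answers(1) finite_subset[OF nb finG] by metis
  qed
  have "(\<Union>u\<in>C. \<Gamma> u) \<subseteq> verts G" using \<Gamma>N nb by blast
  moreover have "{{u, x} |u x. u \<in> C \<and> x \<in> \<Gamma> u} \<subseteq> edges G"
    using \<Gamma>N by (auto simp: neighbors_def)
  ultimately have "S \<union> (\<Union>u\<in>C. \<Gamma> u) \<subseteq> verts K \<and> verts K \<subseteq> verts G \<and> edges K \<subseteq> edges G"
    using Suc.prems(2,3) by (intro Suc.IH[OF _ _ _ K]) auto
  then show ?case by blast
qed

lemma set_traverse:
  assumes "simple_graph G" "v \<in> verts G" "K \<in> set_pmf (traverse G v d l)"
  shows "v \<in> verts K" "verts K \<subseteq> verts G" "edges K \<subseteq> edges G"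
  using set_explore_levels[of G "{v}" "{v}" "{}" K d l] assms by (auto simp: traverse_def)

lemma rbe_rounds_Accept_free:
  assumes G: "simple_graph G" "verts G \<noteq> {}" and free: "subgraph_free G H"
  shows "pmf (rbe_rounds m d l G H) Accept = 1"
proof -
  have fin: "finite (verts G)" using G(1) by (simp add: simple_graph_def)
  have "\<not> contains_copy K H" if "v \<in> verts G" "K \<in> set_pmf (traverse G v d l)" for v K
    using set_traverse[OF G(1) that] contains_copy_mono free unfolding subgraph_free_def by metis
  then have "AE K in measure_pmf (bind_pmf (pmf_of_set (verts G)) (\<lambda>v. traverse G v d l)). K \<in> {K. \<not> contains_copy K H}"
    using fin G(2) by (intro AE_pmfI) auto
  then have "measure_pmf.prob (bind_pmf (pmf_of_set (verts G)) (\<lambda>v. traverse G v d l)) {K. \<not> contains_copy K H} = 1"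
    by (simp add: measure_pmf.prob_eq_1)
  then show ?thesis by (simp add: pmf_rbe_rounds_Accept)
qed

text \<open>Packings presuppose two colours, so a one-vertex \<open>H\<close> is treated apart: the
  start vertex already is a copy.\<close>

lemma contains_copy_single_vertex:
  assumes H: "simple_graph H" "card (verts H) = 1" and v: "v \<in> verts K"
  shows "contains_copy K H"
proof -
  obtain w where w: "verts H = {w}" using H(2) by (auto simp: card_1_singleton_iff)
  have "edges H = {}"
  proof (rule ccontr)
    assume "edges H \<noteq> {}"
    then obtain e where "e \<subseteq> {w}" "card e = 2" using H(1) w by (auto simp: simple_graph_def)
    then show False using card_mono[of "{w}" e] by simp
  qed
  then have "graph_iso \<lparr>verts = {v}, edges = {}\<rparr> H"
    unfolding graph_iso_def using w by (intro exI[of _ "\<lambda>_. w"]) (simp add: bij_betw_def)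
  moreover have "subgraph_of \<lparr>verts = {v}, edges = {}\<rparr> K"
    using v by (simp add: subgraph_of_def simple_graph_def)
  ultimately show ?thesis unfolding contains_copy_def by blast
qed

lemma (in robust_packing) robustness_le_1:
  assumes \<delta>: "0 < \<delta>" and ne: "verts G \<noteq> {}"
  shows "\<delta> \<le> 1"
proof -
  have "0 < card (verts G)" using ne finite_verts by (simp add: card_gt_0_iff)
  then have "0 < real (card used)"
    using card_used \<delta> by (meson less_le_trans mult_pos_pos of_nat_0_less_iff)
  then have "used \<noteq> {}" by auto
  then obtain \<phi> where "\<phi> \<in> Q" by (auto simp: used_def)
  then show ?thesis by (rule delta_le_1)
qed

text \<open>The start vertex lies on a copy with probability at least \<open>\<delta>\<close>, and
  from there the exploration succeeds with probability at least 1/2.\<close>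

lemma (in robust_packing) prob_find_copy:
  assumes \<delta>: "0 < \<delta>" and ne: "verts G \<noteq> {}" and F: "F \<in> patterns H k"
    and d: "k * (1 - \<delta>) ^ d * (\<Sum>j<k * (k * k) + 1. real d ^ j) \<le> 1 / 2"
  shows "measure_pmf.prob (bind_pmf (pmf_of_set (verts G)) (\<lambda>v. traverse G v d (k * (k * k) + 1)))
      {K. \<not> contains_copy K H} \<le> 1 - \<delta> / 2"
proof -
  let ?l = "k * (k * k) + 1"
  have n: "0 < card (verts G)" using ne finite_verts by (simp add: card_gt_0_iff)
  have le1: "\<delta> \<le> 1" using \<delta> ne by (rule robustness_le_1)
  have copy: "contains_copy K H" if u: "u \<in> used" "explored K ?l u" for K u
  proof -
    obtain \<theta> where \<theta>: "inj_on \<theta> {..<k}" "\<theta> ` {..<k} \<subseteq> verts K"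
      "\<And>i j. {i, j} \<in> F \<Longrightarrow> {\<theta> i, \<theta> j} \<in> edges K"
      using explored_copy[OF u] by blast
    have "\<theta> ` e \<in> edges K" if "e \<in> F" for e
    proof -
      have "card e = 2" using pattern(1) that by (simp add: simple_graph_def)
      then obtain i j where "e = {i, j}" by (auto simp: card_2_iff)
      then show ?thesis using \<theta>(3)[of i j] that by simp
    qed
    moreover have "graph_iso \<lparr>verts = {..<k}, edges = F\<rparr> H" using F by (simp add: patterns_def)
    ultimately show ?thesis by (intro contains_copyI[OF _ pattern(1) \<theta>(1,2)])
  qed
  let ?t = "bind_pmf (pmf_of_set (verts G)) (\<lambda>v. traverse G v d ?l)"
  have half: "indicator used v * (1 / 2) \<le> measure_pmf.prob (traverse G v d ?l) {K. contains_copy K H}" for v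
  proof (cases "v \<in> used")
    case True
    have "1 / 2 \<le> measure_pmf.prob (traverse G v d ?l) {K. explored K ?l v}"
      using prob_traverse[OF le1, of d ?l v] d by linarith
    also have "\<dots> \<le> measure_pmf.prob (traverse G v d ?l) {K. contains_copy K H}"
      using copy[OF True] by (intro measure_pmf.finite_measure_mono) auto
    finally show ?thesis using True by simp
  qed simp
  have "\<delta> / 2 \<le> card used / card (verts G) * (1 / 2)"
    using card_used n by (simp add: field_simps)
  also have "card used / card (verts G) = measure_pmf.prob (pmf_of_set (verts G)) used"
    using ne finite_verts used_subset by (simp add: measure_pmf_of_set Int_absorb1)
  also have "\<dots> * (1 / 2) = (\<integral>v. indicator used v * (1 / 2) \<partial>measure_pmf (pmf_of_set (verts G)))"
    by simp
  also have "\<dots> \<le> (\<integral>v. measure_pmf.prob (traverse G v d ?l) {K. contains_copy K H} \<partial>measure_pmf (pmf_of_set (verts G)))"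
    using half by (intro integral_mono_AE measure_pmf.integrable_const_bound[where B = 1])
      (auto simp: indicator_def)
  also have "\<dots> = measure_pmf.prob ?t {K. contains_copy K H}" by (simp add: prob_bind_pmf)
  finally have "\<delta> / 2 \<le> measure_pmf.prob ?t {K. contains_copy K H}" .
  moreover have "measure_pmf.prob ?t {K. \<not> contains_copy K H} = 1 - measure_pmf.prob ?t {K. contains_copy K H}"
    using measure_pmf.prob_compl[of "{K. contains_copy K H}" ?t] by (simp add: Collect_neg_eq Compl_eq_Diff_UNIV)
  ultimately show "measure_pmf.prob ?t {K. \<not> contains_copy K H} \<le> 1 - \<delta> / 2" by simp
qed

text \<open>The parameters are fixed before \<open>G\<close>: the constant \<open>\<delta>\<close>
  depends only on \<open>\<epsilon>\<close>, \<open>card (verts H)\<close> and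
  \<open>card (verts L)\<close>.\<close>

lemma ex_parameters:
  fixes L :: "'l ugraph" and H :: "'h ugraph" and \<epsilon> :: real
  assumes L: "simple_graph L" and H: "simple_graph H" "connected_graph H" and \<epsilon>: "0 < \<epsilon>"
  shows "\<exists>m l d. m > 0 \<and> l > 0 \<and> d > 0 \<and>
    (\<forall>G :: 'a ugraph. verts G \<noteq> {} \<and> simple_graph G \<and> minor_free G L \<and> far_from_free \<epsilon> G H \<longrightarrow>
      pmf (rbe_rounds m d l G H) Accept \<le> 1 / 100)"
proof -
  define k where "k = card (verts H)"
  have "finite (verts H)" "verts H \<noteq> {}" using H by (auto simp: simple_graph_def connected_graph_def)
  then have "0 < k" by (simp add: k_def card_gt_0_iff)
  then consider "k = 1" | "2 \<le> k" by linarith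
  then show ?thesis
  proof cases
    case 1
    have "pmf (rbe_rounds 1 1 1 G H) Accept \<le> 1 / 100"
      if G: "verts G \<noteq> {}" "simple_graph G" for G :: "'a ugraph"
    proof -
      have fin: "finite (verts G)" using G(2) by (simp add: simple_graph_def)
      let ?t = "bind_pmf (pmf_of_set (verts G)) (\<lambda>v. traverse G v 1 1)"
      have "contains_copy K H" if "v \<in> verts G" "K \<in> set_pmf (traverse G v 1 1)" for v K
        using set_traverse(1)[OF G(2) that] contains_copy_single_vertex[OF H(1)] 1 k_def by metis
      then have "set_pmf ?t \<inter> {K. \<not> contains_copy K H} = {}" using fin G(1) by auto
      then have "measure_pmf.prob ?t {K. \<not> contains_copy K H} = 0"
        by (simp add: measure_pmf_zero_iff)
      then show ?thesis unfolding pmf_rbe_rounds_Accept by simp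
    qed
    then show ?thesis by (intro exI[of _ 1]) auto
  next
    case 2
    define C :: nat where "C = 2 ^ Suc (card (verts L))"
    define \<eta> where "\<eta> = \<epsilon> / (2 ^ k * 2 ^ (2 ^ k) * k ^ k)"
    define \<delta> where "\<delta> = (shrink C ^^ (k * k)) \<eta> / (2 * C)"
    define l where "l = k * (k * k) + 1"
    have C: "0 < C" by (simp add: C_def)
    have \<eta>: "0 < \<eta>" using \<epsilon> 2 by (simp add: \<eta>_def)
    have \<delta>: "0 < \<delta>" unfolding \<delta>_def using shrink_pos[OF C \<eta>] C by simp
    have packing: "\<exists>F\<in>patterns H k. \<exists>Q. robust_packing G k F Q \<delta>"
      if G: "verts G \<noteq> {}" "simple_graph G" "minor_free G L" "far_from_free \<epsilon> G H" for G :: "'a ugraph"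
    proof -
      obtain F Q where F: "F \<in> patterns H k" "packing G k F Q" "\<eta> * card (verts G) \<le> card Q"
        using far_packing[OF G(4,2) H k_def 2] unfolding \<eta>_def by blast
      have "sparse_minors C G"
        unfolding sparse_minors_def C_def using minor_free_links[OF G(2,3) L] by blast
      then show ?thesis
        using packing.ex_robust_packing[OF F(2) _ C \<eta> F(3) G(1)] F(1) unfolding \<delta>_def by blast
    qed
    show ?thesis
    proof (cases "\<delta> \<le> 1")
      case True
      obtain d where d: "d > 0" "k * (1 - \<delta>) ^ d * (\<Sum>j<l. real d ^ j) \<le> 1 / 2"
        using ex_query_number[OF \<delta> True, of l k] by (auto simp: l_def)
      have "(\<lambda>m. (1 - \<delta> / 2) ^ m) \<longlonglongrightarrow> 0"
        using \<delta> True by (intro LIMSEQ_realpow_zero) auto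
      then have "\<forall>\<^sub>F m in sequentially. (1 - \<delta> / 2) ^ m < 1 / 100" by (rule order_tendstoD) simp
      then have "\<forall>\<^sub>F m in sequentially. (1 - \<delta> / 2) ^ m < 1 / 100 \<and> 0 < m"
        using eventually_gt_at_top by (rule eventually_conj)
      then obtain m where m: "(1 - \<delta> / 2) ^ m < 1 / 100" "0 < m"
        using eventually_happens by force
      have "pmf (rbe_rounds m d l G H) Accept \<le> 1 / 100"
        if G: "verts G \<noteq> {}" "simple_graph G" "minor_free G L" "far_from_free \<epsilon> G H" for G :: "'a ugraph"
      proof -
        obtain F Q where F: "F \<in> patterns H k" "robust_packing G k F Q \<delta>" using packing[OF G] by blast
        have "pmf (rbe_rounds m d l G H) Accept \<le> (1 - \<delta> / 2) ^ m"
          unfolding pmf_rbe_rounds_Accept l_def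
          using robust_packing.prob_find_copy[OF F(2) \<delta> G(1) F(1) d(2)[unfolded l_def]]
          by (intro power_mono) auto
        then show ?thesis using m(1) by simp
      qed
      then show ?thesis using m(2) d(1) by (intro exI[of _ m] exI[of _ l] exI[of _ d]) (auto simp: l_def)
    next
      case False
      \<comment> \<open>For \<open>\<delta> > 1\<close> there is no such \<open>G\<close>, because
        its robust packing would enforce \<open>\<delta> \<le> 1\<close>; any positive parameters
        will do.\<close>
      have "\<not> (verts G \<noteq> {} \<and> simple_graph G \<and> minor_free G L \<and> far_from_free \<epsilon> G H)" for G :: "'a ugraph"
      proof
        assume G: "verts G \<noteq> {} \<and> simple_graph G \<and> minor_free G L \<and> far_from_free \<epsilon> G H"
        then obtain F Q where F: "F \<in> patterns H k" "robust_packing G k F Q \<delta>" using packing by blast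
        then show False
          using robust_packing.robustness_le_1[OF F(2) \<delta>] G False by blast
      qed
      then show ?thesis by (intro exI[of _ 1]) blast
    qed
  qed
qed

theorem theorem9p1:
  fixes L :: "'l ugraph"
  assumes "simple_graph L"
  shows "\<exists>f g h :: real \<Rightarrow> 'h ugraph \<Rightarrow> nat.
    (\<forall>\<epsilon> H. f \<epsilon> H > 0 \<and> g \<epsilon> H > 0 \<and> h \<epsilon> H > 0) \<and>
    (\<forall>H. simple_graph H \<and> connected_graph H \<longrightarrow>
      (\<forall>\<epsilon>::real. 0 < \<epsilon> \<and> \<epsilon> < 1 \<longrightarrow>
        (\<forall>(n::nat) (G :: nat ugraph).
          n \<ge> 1 \<and> verts G = {1..n} \<and> simple_graph G \<and> minor_free G L \<longrightarrow>
            (subgraph_free G H \<longrightarrow> pmf (rbe f g h G H \<epsilon>) Accept = 1) \<and>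
            (far_from_free \<epsilon> G H \<longrightarrow> pmf (rbe f g h G H \<epsilon>) Reject \<ge> 0.99))))"
proof -
  \<comment> \<open>Positivity stands outside the implication, so that the functions obtained by
    choice are positive at every argument, also where \<open>H\<close> or \<open>\<epsilon>\<close>
    violates the hypotheses.\<close>
  define ok where "ok \<epsilon> H m l d \<longleftrightarrow> m > 0 \<and> l > 0 \<and> d > 0 \<and>
    (simple_graph H \<and> connected_graph H \<and> 0 < \<epsilon> \<longrightarrow>
      (\<forall>G :: nat ugraph. verts G \<noteq> {} \<and> simple_graph G \<and> minor_free G L \<and> far_from_free \<epsilon> G H \<longrightarrow>
        pmf (rbe_rounds m d l G H) Accept \<le> 1 / 100))"
    for \<epsilon> :: real and H :: "'h ugraph" and m l d :: nat
  have "\<exists>m l d. ok \<epsilon> H m l d" for \<epsilon> H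
  proof (cases "simple_graph H \<and> connected_graph H \<and> 0 < \<epsilon>")
    case True
    then show ?thesis using ex_parameters[OF assms, of H \<epsilon>, where 'a = nat] unfolding ok_def by blast
  next
    case False
    then have "ok \<epsilon> H 1 1 1" unfolding ok_def by (auto simp del: rbe_rounds.simps)
    then show ?thesis by blast
  qed
  then obtain f g h where ok: "\<And>\<epsilon> H. ok \<epsilon> H (f \<epsilon> H) (g \<epsilon> H) (h \<epsilon> H)" by metis
  show ?thesis
  proof (rule exI[of _ f], rule exI[of _ g], rule exI[of _ h], intro conjI allI impI)
    fix \<epsilon> :: real and H :: "'h ugraph"
    show "f \<epsilon> H > 0" "g \<epsilon> H > 0" "h \<epsilon> H > 0" using ok[of \<epsilon> H] by (simp_all add: ok_def)
  next
    fix H :: "'h ugraph" and \<epsilon> :: real and n :: nat and G :: "nat ugraph"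
    assume "n \<ge> 1 \<and> verts G = {1..n} \<and> simple_graph G \<and> minor_free G L"
    then have G: "verts G \<noteq> {}" "simple_graph G" "minor_free G L" by auto
    show "pmf (rbe f g h G H \<epsilon>) Accept = 1" if "subgraph_free G H"
      unfolding rbe_def using rbe_rounds_Accept_free[OF G(2,1) that] .
    assume "simple_graph H \<and> connected_graph H" "0 < \<epsilon> \<and> \<epsilon> < 1" and far: "far_from_free \<epsilon> G H"
    then have "pmf (rbe f g h G H \<epsilon>) Accept \<le> 1 / 100"
      unfolding rbe_def using ok[of \<epsilon> H] G far unfolding ok_def by blast
    then show "pmf (rbe f g h G H \<epsilon>) Reject \<ge> 0.99" by (simp add: pmf_Reject)
  qed
qed

end
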